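(* Let $\Omega\subset\mathbb R^d$ be a bounded domain with $C^{1,1}$ boundary, let $p>d$, $R>0$, $T_0>0$, and let the initial data $g_1,g_2$ be sufficiently regular for the following assumptions to be meaningful, with $z_1M_1^0+z_2M_2^0=0$, $M_i^0=\int_\Omega g_i\,dx$. Assume that, for $0<T\le T_0$ and with constants $C_R$ and $C_P$ that can be chosen uniformly for $0<T\le T_0$, the following hold. (i) For every $\psi\in\mathbb B_R^p$ the linearized Nernst--Planck subproblem defining $S_i(\psi)$ ($i=1,2$) is uniquely solvable in $\mathcal X_T^p$, preserves the species masses, $\int_\Omega S_i(\psi)(x,t)\,dx=M_i^0$ for a.e. $t\in(0,T)$, and satisfies $$\sum_{i=1}^2\|S_i(\psi)\|_{\mathcal X_T^p}+\sum_{i=1}^2\|S_i(\psi)\|_{L^\infty(Q)}\le C_R.$$ (ii) For all $\psi,\tilde\psi\in\mathbb B_R^p$, $$\sum_{i=1}^2\|S_i(\psi)-S_i(\tilde\psi)\|_{L^\infty(0,T;L^p(\Omega))}\le C_RT^{1/2}\|\psi-\tilde\psi\|_{\mathcal W_T^p}.$$ (iii) The Neumann Poisson operator $P:\mathcal A_T^p\to\mathcal W_T^p$ satisfies, for all $(c_1,c_2),(\tilde c_1,\tilde c_2)\in\mathcal A_T^p$, $$\|P(c_1,c_2)-P(\tilde c_1,\tilde c_2)\|_{\mathcal W_T^p}\le C_P\sum_{i=1}^2\|c_i-\tilde c_i\|_{L^\infty(0,T;L^p(\Omega))}.$$ (iv) The map $\mathcal T(\psi):=P(S_1(\psi),S_2(\psi))$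 satisfies $\mathcal T(\mathbb B_R^p)\subset\mathbb B_R^p$. Then there exists $T_*\in(0,T_0]$, depending on $R,\Omega,p,D_i,z_i,\epsilon_p$ and the initial data, such that for every $0<T\le T_*$ the map $\mathcal T$ is a contraction on $\mathbb B_R^p$; more precisely, for all $\psi,\tilde\psi\in\mathbb B_R^p$, $$\|\mathcal T(\psi)-\mathcal T(\tilde\psi)\|_{\mathcal W_T^p}\le q\|\psi-\tilde\psi\|_{\mathcal W_T^p},\qquad q:=C_PC_RT^{1/2}<1.$$ Consequently, $\mathcal T$ has a unique fixed point $\psi^*\in\mathbb B_R^p$, and the Picard iteration $\psi^{n+1}=\mathcal T(\psi^n)$ (with $\psi^0\in\mathbb B_R^p$) converges in $\mathcal W_T^p$ to $\psi^*$. The associated concentrations $c_i^{n+1}=S_i(\psi^n)$ converge to $c_i^*=S_i(\psi^* )$ in $L^\infty(0,T;L^p(\Omega))$.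
   Context: $Q=\Omega\times(0,T)$; $D_1,D_2>0$, $z_1,z_2\in\mathbb R$, $\epsilon_p>0$ are constants; $\mathbf n$ is the outward unit normal. Define $\mathcal W_T^p=\{\psi\in L^\infty(0,T;W^{2,p}(\Omega)):\int_\Omega\psi(\mathbf x,t)\,d\mathbf x=0\text{ for a.e. }t\in(0,T)\}$ with norm $\|\psi\|_{\mathcal W_T^p}=\|\psi\|_{L^\infty(0,T;W^{2,p}(\Omega))}$; $\mathcal X_T^p=L^\infty(0,T;L^p(\Omega))\cap L^2(0,T;W^{1,p}(\Omega))$; $\mathbb B_R^p=\{\psi\in\mathcal W_T^p:\|\psi\|_{\mathcal W_T^p}\le R\}$. For $\psi\in\mathbb B_R^p$, $S_i(\psi)$ denotes the solution $c$ of the linearized Nernst--Planck subproblem $\partial_tc=D_i\nabla\cdot(\nabla c+z_ic\nabla\psi)$ in $Q$ with homogeneous no-flux boundary condition $D_i(\nabla c+z_ic\nabla\psi)\cdot\mathbf n=0$ on $\partial\Omega\times(0,T)$ and initial datum $c(\cdot,0)=g_i$. The admissible class is $\mathcal A_T^p=\{(c_1,c_2)\in(\mathcal X_T^p)^2: z_1\int_\Omega c_1(x,t)\,dx+z_2\int_\Omega c_2(x,t)\,dx=0\text{ for a.e. }t\in(0,T)\}$. For $(c_1,c_2)\in\mathcal A_T^p$, $P(c_1,c_2)$ is the zero-mean solution $\phi$ of $-\epsilon_p^2\Delta\phi=z_1c_1+z_2c_2$ in $\Omega$ with $\partial_{\mathbf n}\phi=0$ on $\partial\Omega$, for a.e.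 $t\in(0,T)$. *)

theory Defs
  imports "HOL-Analysis.Analysis"
begin

text \<open>
  Elements of Lebesgue, Sobolev and Bochner spaces are represented by functions; the norms are
  therefore seminorms, and equality of elements means equality almost everywhere.  An element of a
  space of functions of time with values in a space on \<open>\<Omega>\<close> is a function \<open>u\<close> with \<open>u t x\<close> the value
  at time \<open>t\<close> and position \<open>x\<close>.
\<close>

section \<open>Domains\<close>

text \<open>
  Near each boundary point \<open>\<Omega>\<close> is, in suitable orthonormal coordinates with last axis \<open>e\<close>, the region
  above the graph of \<open>\<gamma>\<close>.  Only the values of \<open>\<gamma>\<close> on the hyperplane orthogonal to \<open>e\<close> are used; a
  \<open>C\<^sup>1\<^sup>,\<^sup>1\<close> function on the hyperplane extends to the whole space, constantly in direction \<open>e\<close>.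
\<close>

definition C11_boundary :: "'a::euclidean_space set \<Rightarrow> bool" where
  "C11_boundary \<Omega> \<longleftrightarrow>
     (\<forall>x0\<in>frontier \<Omega>. \<exists>r>0. \<exists>e (\<gamma> :: 'a \<Rightarrow> real) (G :: 'a \<Rightarrow> 'a) L.
        norm e = 1 \<and>
        (\<forall>x. (\<gamma> has_derivative (\<lambda>h. G x \<bullet> h)) (at x)) \<and> L-lipschitz_on UNIV G \<and>
        \<Omega> \<inter> ball x0 r = {x \<in> ball x0 r. x \<bullet> e > \<gamma> (x - (x \<bullet> e) *\<^sub>R e)})"

definition C11_bounded_domain :: "'a::euclidean_space set \<Rightarrow> bool" where
  "C11_bounded_domain \<Omega> \<longleftrightarrow>
     open \<Omega> \<and> connected \<Omega> \<and> \<Omega> \<noteq> {} \<and> bounded \<Omega> \<and> C11_boundary \<Omega>"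

text \<open>
  On a \<open>C\<^sup>1\<close> domain exactly one unit vector satisfies this at each boundary point: directions with
  negative normal component enter \<open>\<Omega>\<close>, those with positive normal component leave its closure.
\<close>

definition outward_unit_normal :: "'a::euclidean_space set \<Rightarrow> 'a \<Rightarrow> 'a \<Rightarrow> bool" where
  "outward_unit_normal \<Omega> x n \<longleftrightarrow>
     norm n = 1 \<and>
     (\<forall>v. v \<bullet> n < 0 \<longrightarrow> (\<exists>\<delta>>0. \<forall>s. 0 < s \<and> s < \<delta> \<longrightarrow> x + s *\<^sub>R v \<in> \<Omega>)) \<and>
     (\<forall>v. v \<bullet> n > 0 \<longrightarrow> (\<exists>\<delta>>0. \<forall>s. 0 < s \<and> s < \<delta> \<longrightarrow> x + s *\<^sub>R v \<notin> closure \<Omega>))"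

section \<open>Smooth functions, Lebesgue and Sobolev spaces\<close>

definition dir_deriv :: "'a::euclidean_space \<Rightarrow> ('a \<Rightarrow> real) \<Rightarrow> 'a \<Rightarrow> real" where
  "dir_deriv v f x = frechet_derivative f (at x) v"

definition iter_deriv :: "'a::euclidean_space list \<Rightarrow> ('a \<Rightarrow> real) \<Rightarrow> 'a \<Rightarrow> real" where
  "iter_deriv vs f = foldr dir_deriv vs f"

definition smooth :: "('a::euclidean_space \<Rightarrow> real) \<Rightarrow> bool" where
  "smooth f \<longleftrightarrow> (\<forall>vs\<in>lists Basis. \<forall>x. iter_deriv vs f differentiable (at x))"

definition test_functions :: "'a::euclidean_space set \<Rightarrow> ('a \<Rightarrow> real) set" where
  "test_functions \<Omega> =
     {\<phi>. smooth \<phi> \<and> compact (closure {x. \<phi> x \<noteq> 0}) \<and> closure {x. \<phi> x \<noteq> 0} \<subseteq> \<Omega>}"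

definition Lp :: "real \<Rightarrow> 'a::euclidean_space set \<Rightarrow> ('a \<Rightarrow> real) set" where
  "Lp p \<Omega> = {u. u \<in> borel_measurable (lebesgue_on \<Omega>) \<and>
                integrable (lebesgue_on \<Omega>) (\<lambda>x. \<bar>u x\<bar> powr p)}"

definition Lp_norm :: "real \<Rightarrow> 'a::euclidean_space set \<Rightarrow> ('a \<Rightarrow> real) \<Rightarrow> real" where
  "Lp_norm p \<Omega> u = (LINT x|lebesgue_on \<Omega>. \<bar>u x\<bar> powr p) powr (1 / p)"

definition locally_integrable :: "'a::euclidean_space set \<Rightarrow> ('a \<Rightarrow> real) \<Rightarrow> bool" where
  "locally_integrable \<Omega> u \<longleftrightarrow> (\<forall>K. compact K \<and> K \<subseteq> \<Omega> \<longrightarrow> integrable (lebesgue_on K) u)"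

text \<open>
  A list of basis vectors plays the role of a multi-index: \<open>[i, j]\<close> stands for the mixed derivative in
  directions \<open>i\<close> and \<open>j\<close>, and \<open>[]\<close> for the function itself.
\<close>

definition has_weak_deriv ::
  "'a::euclidean_space set \<Rightarrow> 'a list \<Rightarrow> ('a \<Rightarrow> real) \<Rightarrow> ('a \<Rightarrow> real) \<Rightarrow> bool" where
  "has_weak_deriv \<Omega> is u v \<longleftrightarrow>
     locally_integrable \<Omega> u \<and> locally_integrable \<Omega> v \<and>
     (\<forall>\<phi>\<in>test_functions \<Omega>.
        (LINT x|lebesgue_on \<Omega>. u x * iter_deriv is \<phi> x) =
        (- 1) ^ length is * (LINT x|lebesgue_on \<Omega>. v x * \<phi> x))"

definition weak_deriv ::
  "'a::euclidean_space set \<Rightarrow> 'a list \<Rightarrow> ('a \<Rightarrow> real) \<Rightarrow> 'a \<Rightarrow> real" where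
  "weak_deriv \<Omega> is u = (SOME v. has_weak_deriv \<Omega> is u v)"

definition weak_grad :: "'a::euclidean_space set \<Rightarrow> ('a \<Rightarrow> real) \<Rightarrow> 'a \<Rightarrow> 'a" where
  "weak_grad \<Omega> u x = (\<Sum>i\<in>Basis. weak_deriv \<Omega> [i] u x *\<^sub>R i)"

definition weak_laplacian :: "'a::euclidean_space set \<Rightarrow> ('a \<Rightarrow> real) \<Rightarrow> 'a \<Rightarrow> real" where
  "weak_laplacian \<Omega> u x = (\<Sum>i\<in>Basis. weak_deriv \<Omega> [i, i] u x)"

definition deriv_indices :: "nat \<Rightarrow> 'a::euclidean_space list set" where
  "deriv_indices k = {is. set is \<subseteq> Basis \<and> length is \<le> k}"

definition Sobolev :: "nat \<Rightarrow> real \<Rightarrow> 'a::euclidean_space set \<Rightarrow> ('a \<Rightarrow> real) set" where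
  "Sobolev k p \<Omega> = {u. \<forall>is\<in>deriv_indices k. \<exists>v\<in>Lp p \<Omega>. has_weak_deriv \<Omega> is u v}"

definition Sobolev_norm :: "nat \<Rightarrow> real \<Rightarrow> 'a::euclidean_space set \<Rightarrow> ('a \<Rightarrow> real) \<Rightarrow> real" where
  "Sobolev_norm k p \<Omega> u =
     (\<Sum>is\<in>deriv_indices k. Lp_norm p \<Omega> (weak_deriv \<Omega> is u) powr p) powr (1 / p)"

section \<open>Bochner spaces on the time interval \<open>(0, T)\<close>\<close>

text \<open>\<open>V\<close> is the underlying space and \<open>N\<close> its (semi)norm.\<close>

definition strongly_measurable ::
  "real \<Rightarrow> ('a \<Rightarrow> real) set \<Rightarrow> (('a \<Rightarrow> real) \<Rightarrow> real) \<Rightarrow> (real \<Rightarrow> 'a \<Rightarrow> real) \<Rightarrow> bool" where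
  "strongly_measurable T V N u \<longleftrightarrow>
     (\<exists>s :: nat \<Rightarrow> real \<Rightarrow> 'a \<Rightarrow> real.
        (\<forall>n. simple_function (lebesgue_on {0<..<T}) (s n) \<and> s n ` {0<..<T} \<subseteq> V) \<and>
        (AE t in lebesgue_on {0<..<T}. (\<lambda>n. N (s n t - u t)) \<longlonglongrightarrow> 0))"

definition Linf_time ::
  "real \<Rightarrow> ('a \<Rightarrow> real) set \<Rightarrow> (('a \<Rightarrow> real) \<Rightarrow> real) \<Rightarrow> (real \<Rightarrow> 'a \<Rightarrow> real) set" where
  "Linf_time T V N =
     {u. strongly_measurable T V N u \<and> (AE t in lebesgue_on {0<..<T}. u t \<in> V) \<and>
         (\<exists>C. AE t in lebesgue_on {0<..<T}. N (u t) \<le> C)}"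

definition Linf_time_norm ::
  "real \<Rightarrow> (('a \<Rightarrow> real) \<Rightarrow> real) \<Rightarrow> (real \<Rightarrow> 'a \<Rightarrow> real) \<Rightarrow> real" where
  "Linf_time_norm T N u = Inf {C. 0 \<le> C \<and> (AE t in lebesgue_on {0<..<T}. N (u t) \<le> C)}"

definition Lq_time ::
  "real \<Rightarrow> real \<Rightarrow> ('a \<Rightarrow> real) set \<Rightarrow> (('a \<Rightarrow> real) \<Rightarrow> real) \<Rightarrow> (real \<Rightarrow> 'a \<Rightarrow> real) set" where
  "Lq_time q T V N =
     {u. strongly_measurable T V N u \<and> (AE t in lebesgue_on {0<..<T}. u t \<in> V) \<and>
         integrable (lebesgue_on {0<..<T}) (\<lambda>t. N (u t) powr q)}"

definition Lq_time_norm ::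
  "real \<Rightarrow> real \<Rightarrow> (('a \<Rightarrow> real) \<Rightarrow> real) \<Rightarrow> (real \<Rightarrow> 'a \<Rightarrow> real) \<Rightarrow> real" where
  "Lq_time_norm q T N u = (LINT t|lebesgue_on {0<..<T}. N (u t) powr q) powr (1 / q)"

abbreviation LinfLp_norm ::
  "'a::euclidean_space set \<Rightarrow> real \<Rightarrow> real \<Rightarrow> (real \<Rightarrow> 'a \<Rightarrow> real) \<Rightarrow> real" where
  "LinfLp_norm \<Omega> p T \<equiv> Linf_time_norm T (Lp_norm p \<Omega>)"

text \<open>
  The essential supremum over \<open>Q = \<Omega> \<times> (0, T)\<close> is taken first in \<open>x\<close> and then in \<open>t\<close>.  By Fubini this
  is the usual one for jointly measurable functions, and it does not depend on the representative
  chosen for each \<open>u t\<close>, which need not be jointly measurable.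
\<close>

definition LinfQ :: "'a::euclidean_space set \<Rightarrow> real \<Rightarrow> (real \<Rightarrow> 'a \<Rightarrow> real) set" where
  "LinfQ \<Omega> T =
     {u. \<exists>C. AE t in lebesgue_on {0<..<T}. AE x in lebesgue_on \<Omega>. \<bar>u t x\<bar> \<le> C}"

definition LinfQ_norm :: "'a::euclidean_space set \<Rightarrow> real \<Rightarrow> (real \<Rightarrow> 'a \<Rightarrow> real) \<Rightarrow> real" where
  "LinfQ_norm \<Omega> T u =
     Inf {C. 0 \<le> C \<and> (AE t in lebesgue_on {0<..<T}. AE x in lebesgue_on \<Omega>. \<bar>u t x\<bar> \<le> C)}"

definition ae_eq ::
  "'a::euclidean_space set \<Rightarrow> real \<Rightarrow> (real \<Rightarrow> 'a \<Rightarrow> real) \<Rightarrow> (real \<Rightarrow> 'a \<Rightarrow> real) \<Rightarrow> bool" where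
  "ae_eq \<Omega> T u v \<longleftrightarrow> (AE t in lebesgue_on {0<..<T}. AE x in lebesgue_on \<Omega>. u t x = v t x)"

section \<open>The spaces of the Poisson--Nernst--Planck iteration\<close>

definition W_space :: "'a::euclidean_space set \<Rightarrow> real \<Rightarrow> real \<Rightarrow> (real \<Rightarrow> 'a \<Rightarrow> real) set" where
  "W_space \<Omega> p T =
     {\<psi> \<in> Linf_time T (Sobolev 2 p \<Omega>) (Sobolev_norm 2 p \<Omega>).
        AE t in lebesgue_on {0<..<T}. (LINT x|lebesgue_on \<Omega>. \<psi> t x) = 0}"

definition W_norm ::
  "'a::euclidean_space set \<Rightarrow> real \<Rightarrow> real \<Rightarrow> (real \<Rightarrow> 'a \<Rightarrow> real) \<Rightarrow> real" where
  "W_norm \<Omega> p T = Linf_time_norm T (Sobolev_norm 2 p \<Omega>)"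

definition X_space :: "'a::euclidean_space set \<Rightarrow> real \<Rightarrow> real \<Rightarrow> (real \<Rightarrow> 'a \<Rightarrow> real) set" where
  "X_space \<Omega> p T =
     Linf_time T (Lp p \<Omega>) (Lp_norm p \<Omega>) \<inter> Lq_time 2 T (Sobolev 1 p \<Omega>) (Sobolev_norm 1 p \<Omega>)"

definition X_norm ::
  "'a::euclidean_space set \<Rightarrow> real \<Rightarrow> real \<Rightarrow> (real \<Rightarrow> 'a \<Rightarrow> real) \<Rightarrow> real" where
  "X_norm \<Omega> p T c = LinfLp_norm \<Omega> p T c + Lq_time_norm 2 T (Sobolev_norm 1 p \<Omega>) c"

definition W_ball ::
  "'a::euclidean_space set \<Rightarrow> real \<Rightarrow> real \<Rightarrow> real \<Rightarrow> (real \<Rightarrow> 'a \<Rightarrow> real) set" where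
  "W_ball \<Omega> p T R = {\<psi> \<in> W_space \<Omega> p T. W_norm \<Omega> p T \<psi> \<le> R}"

text \<open>The two species carry the indices \<open>1\<close> and \<open>2\<close>; other indices are never used.\<close>

definition admissible ::
  "'a::euclidean_space set \<Rightarrow> real \<Rightarrow> real \<Rightarrow> (nat \<Rightarrow> real) \<Rightarrow> (nat \<Rightarrow> real \<Rightarrow> 'a \<Rightarrow> real) set" where
  "admissible \<Omega> p T z =
     {c. (\<forall>i\<in>{1,2}. c i \<in> X_space \<Omega> p T) \<and>
         (AE t in lebesgue_on {0<..<T}. (\<Sum>i\<in>{1,2}. z i * (LINT x|lebesgue_on \<Omega>. c i t x)) = 0)}"

section \<open>The Nernst--Planck and Poisson subproblems\<close>

text \<open>
  Weak formulation: \<open>c\<close> has no time derivative and its flux no boundary trace in general, so the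
  initial datum and the no-flux condition enter through integration by parts against smooth functions
  on \<open>[0, T) \<times> closure \<Omega>\<close> vanishing near \<open>t = T\<close>.  The term \<open>dir_deriv (0, F) \<eta> (t, x)\<close> is the inner
  product of \<open>F\<close> with the spatial gradient of \<open>\<eta>\<close>.
\<close>

definition NP_solution ::
  "'a::euclidean_space set \<Rightarrow> real \<Rightarrow> real \<Rightarrow> real \<Rightarrow> ('a \<Rightarrow> real) \<Rightarrow>
    (real \<Rightarrow> 'a \<Rightarrow> real) \<Rightarrow> (real \<Rightarrow> 'a \<Rightarrow> real) \<Rightarrow> bool" where
  "NP_solution \<Omega> T D z g \<psi> c \<longleftrightarrow>
     (\<forall>\<eta> :: real \<times> 'a \<Rightarrow> real. smooth \<eta> \<and> (\<exists>T'<T. \<forall>t\<ge>T'. \<forall>x. \<eta> (t, x) = 0) \<longrightarrow>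
        (LINT t|lebesgue_on {0<..<T}. LINT x|lebesgue_on \<Omega>.
           - c t x * dir_deriv (1, 0) \<eta> (t, x)
           + D * dir_deriv (0, weak_grad \<Omega> (c t) x + (z * c t x) *\<^sub>R weak_grad \<Omega> (\<psi> t) x) \<eta> (t, x))
        = (LINT x|lebesgue_on \<Omega>. g x * \<eta> (0, x)))"

definition NP_uniquely_solvable ::
  "'a::euclidean_space set \<Rightarrow> real \<Rightarrow> real \<Rightarrow> real \<Rightarrow> real \<Rightarrow> ('a \<Rightarrow> real) \<Rightarrow>
    (real \<Rightarrow> 'a \<Rightarrow> real) \<Rightarrow> bool" where
  "NP_uniquely_solvable \<Omega> p T D z g \<psi> \<longleftrightarrow>
     (\<exists>c\<in>X_space \<Omega> p T. NP_solution \<Omega> T D z g \<psi> c \<and>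
        (\<forall>c'\<in>X_space \<Omega> p T. NP_solution \<Omega> T D z g \<psi> c' \<longrightarrow> ae_eq \<Omega> T c' c))"

definition NP_operator ::
  "'a::euclidean_space set \<Rightarrow> real \<Rightarrow> real \<Rightarrow> real \<Rightarrow> real \<Rightarrow> ('a \<Rightarrow> real) \<Rightarrow>
    (real \<Rightarrow> 'a \<Rightarrow> real) \<Rightarrow> real \<Rightarrow> 'a \<Rightarrow> real" where
  "NP_operator \<Omega> p T D z g \<psi> = (SOME c. c \<in> X_space \<Omega> p T \<and> NP_solution \<Omega> T D z g \<psi> c)"

text \<open>
  For \<open>p > d\<close> the gradient of a \<open>W\<^sup>2\<^sup>,\<^sup>p\<close> function on a \<open>C\<^sup>1\<^sup>,\<^sup>1\<close> domain has a representative \<open>G\<close> that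
  is continuous up to the boundary, through which the Neumann condition is stated pointwise.
\<close>

definition Neumann_Poisson ::
  "'a::euclidean_space set \<Rightarrow> real \<Rightarrow> ('a \<Rightarrow> real) \<Rightarrow> ('a \<Rightarrow> real) \<Rightarrow> bool" where
  "Neumann_Poisson \<Omega> \<epsilon> f u \<longleftrightarrow>
     (AE x in lebesgue_on \<Omega>. - (\<epsilon>\<^sup>2) * weak_laplacian \<Omega> u x = f x) \<and>
     (\<exists>G. continuous_on (closure \<Omega>) G \<and> (AE x in lebesgue_on \<Omega>. G x = weak_grad \<Omega> u x) \<and>
        (\<forall>x\<in>frontier \<Omega>. \<forall>n. outward_unit_normal \<Omega> x n \<longrightarrow> G x \<bullet> n = 0))"

definition Poisson_solutions ::
  "'a::euclidean_space set \<Rightarrow> real \<Rightarrow> real \<Rightarrow> (nat \<Rightarrow> real) \<Rightarrow> real \<Rightarrow>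
    (nat \<Rightarrow> real \<Rightarrow> 'a \<Rightarrow> real) \<Rightarrow> (real \<Rightarrow> 'a \<Rightarrow> real) set" where
  "Poisson_solutions \<Omega> p T z \<epsilon> c =
     {\<phi> \<in> W_space \<Omega> p T.
        AE t in lebesgue_on {0<..<T}. Neumann_Poisson \<Omega> \<epsilon> (\<lambda>x. \<Sum>i\<in>{1,2}. z i * c i t x) (\<phi> t)}"

definition Poisson_operator ::
  "'a::euclidean_space set \<Rightarrow> real \<Rightarrow> real \<Rightarrow> (nat \<Rightarrow> real) \<Rightarrow> real \<Rightarrow>
    (nat \<Rightarrow> real \<Rightarrow> 'a \<Rightarrow> real) \<Rightarrow> real \<Rightarrow> 'a \<Rightarrow> real" where
  "Poisson_operator \<Omega> p T z \<epsilon> c = (SOME \<phi>. \<phi> \<in> Poisson_solutions \<Omega> p T z \<epsilon> c)"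

end

theory Submission
  imports Defs
begin

text \<open>
  The map is a composition of two Lipschitz maps: by hypothesis the Nernst--Planck solution operators
  have constant \<open>C_R * sqrt T\<close> and the Poisson operator has constant \<open>C_P\<close>, so the composition
  contracts as soon as \<open>C_P * C_R * sqrt T < 1\<close>.  The pair of concentrations is admissible for the
  Poisson problem because the masses are preserved and the initial data are neutral.  Everything
  else is the Banach fixed point theorem in the ball of \<open>L\<^sup>\<infinity>(0, T; W\<^sup>2\<^sup>,\<^sup>p(\<Omega>))\<close>, and the real work
  is to show that this ball is complete for the norm built from representatives.  The concentrations
  then converge because their distance is at most \<open>C_R * sqrt T\<close> times that of the potentials.

  Three facts carry the completeness.  First, the Sobolev norm selects some weak derivative, so it
  is a seminorm only because weak derivatives are unique almost everywhere; this is the fundamental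
  lemma of the calculus of variations (\<open>fundamental_lemma_calculus_of_variations\<close>), proved with
  explicit smooth bumps that converge to indicators of boxes.  Secondly, \<open>L\<^sup>p\<close> is complete
  (\<open>Lp_complete\<close>), and convergence in \<open>L\<^sup>p\<close> on a set of finite measure passes to the limit in the
  pairing with test functions, so Sobolev spaces are complete (\<open>Sobolev_complete\<close>).  Thirdly,
  completeness lifts to essentially bounded functions of time (\<open>Linf_geometric_complete\<close>): the
  pointwise limit is again strongly measurable, by a Borel--Cantelli choice of simple functions.

  A seminorm that vanishes on a difference means equality almost everywhere
  (\<open>W_norm_zero_iff_ae_eq\<close>), which turns the fixed point up to seminorm into one up to null sets.
  All completeness statements are made for sequences with geometrically decaying increments.  Picard
  iterates are of this kind, and for them the sums of increments converge without passing to
  subsequences.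
\<close>

section \<open>Smooth bumps supported in boxes\<close>

text \<open>
  Smoothness quantifies over all iterated derivatives; a family that is closed under
  differentiation contains them all, which reduces the claim to first derivatives.
\<close>

lemma smooth_if_derivative_closed:
  assumes "f \<in> F"
    and "\<And>g x. g \<in> F \<Longrightarrow> g differentiable (at x)"
    and "\<And>g b. g \<in> F \<Longrightarrow> b \<in> Basis \<Longrightarrow> dir_deriv b g \<in> F"
  shows "smooth f"
proof -
  have "iter_deriv vs f \<in> F" if "set vs \<subseteq> Basis" for vs
    using that
  proof (induction vs)
    case Nil
    then show ?case using assms(1) by (simp add: iter_deriv_def)
  next
    case (Cons v vs)
    then show ?case using assms(3)[of "iter_deriv vs f" v] by (simp add: iter_deriv_def)
  qed
  then show ?thesis using assms(2) by (auto simp: smooth_def lists_eq_set)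
qed

lemma DERIV_zero_if_quadratically_flat:
  fixes f :: "real \<Rightarrow> real"
  assumes "f x0 = 0" "\<And>x. \<bar>f x\<bar> \<le> C * \<bar>x - x0\<bar>^2"
  shows "(f has_real_derivative 0) (at x0)"
proof -
  have "((\<lambda>x. (f x - f x0) / (x - x0)) \<longlongrightarrow> 0) (at x0)"
  proof (rule Lim_null_comparison)
    show "\<forall>\<^sub>F x in at x0. norm ((f x - f x0) / (x - x0)) \<le> C * \<bar>x - x0\<bar>"
    proof (intro eventually_at_filter[THEN iffD2] always_eventually allI impI)
      fix x assume "x \<noteq> x0"
      then show "norm ((f x - f x0) / (x - x0)) \<le> C * \<bar>x - x0\<bar>"
        using assms(2)[of x] assms(1) by (simp add: divide_simps power2_eq_square mult.assoc del: abs_mult_self_eq)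
    qed
    have "((\<lambda>x. C * \<bar>x - x0\<bar>) \<longlongrightarrow> C * \<bar>x0 - x0\<bar>) (at x0)"
      by (intro tendsto_intros)
    then show "((\<lambda>x. C * \<bar>x - x0\<bar>) \<longlongrightarrow> 0) (at x0)" by simp
  qed
  then show ?thesis by (simp add: has_field_derivative_iff)
qed

definition gap :: "real \<Rightarrow> real \<Rightarrow> real poly" where
  "gap a c = [:-a, 1:] * [:c, -1:]"

lemma poly_gap [simp]: "poly (gap a c) x = (x - a) * (c - x)"
  by (simp add: gap_def algebra_simps)

text \<open>
  For \<open>P = 1\<close> and \<open>m = 0\<close> this is the usual bump \<open>exp (-
  \<delta> / ((x - a) * (c - x)))\<close>.  The factors \<open>P\<close> and \<open>m\<close>
  make the family closed under differentiation.
\<close>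

definition bump :: "real \<Rightarrow> real \<Rightarrow> real \<Rightarrow> real poly \<Rightarrow> nat \<Rightarrow> real \<Rightarrow> real" where
  "bump \<delta> a c P m x =
     (if a < x \<and> x < c
      then poly P x / ((x - a) * (c - x)) ^ m * exp (- \<delta> / ((x - a) * (c - x))) else 0)"

lemma exp_minus_inverse_le_power:
  fixes \<delta> q :: real
  assumes "\<delta> > 0" "q > 0" "k > 0"
  shows "exp (- \<delta> / q) \<le> real k ^ k * q ^ k / \<delta> ^ k"
proof -
  have "(\<delta> / q / real k) ^ k \<le> (1 + \<delta> / q / real k) ^ k"
    using assms by (intro power_mono) auto
  also have "\<dots> \<le> exp (\<delta> / q)"
    using assms by (intro exp_ge_one_plus_x_over_n_power_n) (auto intro: order_trans[of "- real k" 0])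
  finally have "inverse (exp (\<delta> / q)) \<le> inverse ((\<delta> / q / real k) ^ k)"
    using assms by (intro le_imp_inverse_le) auto
  then show ?thesis using assms by (simp add: exp_minus field_simps)
qed

text \<open>
  The exponential beats every power of the gap to the endpoints, hence also the pole of order
  \<open>m\<close>.  With exponent \<open>m + 2\<close> a quadratic zero remains, which makes
  the derivative vanish at the endpoints and outside the interval.
\<close>

lemma bump_flat:
  assumes "\<delta> > 0" "x0 \<le> a \<or> c \<le> x0"
  shows "\<exists>C. \<forall>x. \<bar>bump \<delta> a c P m x\<bar> \<le> C * \<bar>x - x0\<bar>^2"
proof -
  have "bounded (poly P ` {a..c})"
    by (intro compact_imp_bounded compact_continuous_image continuous_intros) auto
  then obtain B where B: "\<And>x. x \<in> {a..c} \<Longrightarrow> \<bar>poly P x\<bar> \<le> B" "B > 0"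
    unfolding bounded_pos by fastforce
  define C where "C = B * (real (m + 2) ^ (m + 2) / \<delta> ^ (m + 2)) * (c - a)^2"
  have "\<bar>bump \<delta> a c P m x\<bar> \<le> C * \<bar>x - x0\<bar>^2" for x
  proof (cases "a < x \<and> x < c")
    case True
    define q where "q = (x - a) * (c - x)"
    have q: "q > 0" using True by (simp add: q_def)
    have "\<bar>bump \<delta> a c P m x\<bar> = \<bar>poly P x\<bar> / q ^ m * exp (- \<delta> / q)"
      using True q by (simp add: bump_def q_def abs_mult)
    also have "\<dots> \<le> B / q ^ m * (real (m + 2) ^ (m + 2) * q ^ (m + 2) / \<delta> ^ (m + 2))"
      using B(1)[of x] True q B(2) assms exp_minus_inverse_le_power[OF assms(1) q, of "m+2"]
      by (intro mult_mono divide_right_mono) auto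
    also have "\<dots> = B * (real (m + 2) ^ (m + 2) / \<delta> ^ (m + 2)) * q^2"
    proof -
      have "B / q ^ m * (F * q ^ (m + 2) / D) = B * (F / D) * q^2" for F D
        using q by (simp add: power_add field_simps power2_eq_square)
      then show ?thesis .
    qed
    also have "\<dots> \<le> B * (real (m + 2) ^ (m + 2) / \<delta> ^ (m + 2)) * (\<bar>x - x0\<bar> * (c - a))^2"
    proof (intro mult_left_mono power_mono)
      show "q \<le> \<bar>x - x0\<bar> * (c - a)"
      proof (cases "x0 \<le> a")
        case True
        then show ?thesis unfolding q_def using \<open>a < x \<and> x < c\<close> by (intro mult_mono) auto
      next
        case False
        then have "(c - x) * (x - a) \<le> \<bar>x - x0\<bar> * (c - a)"
          using \<open>a < x \<and> x < c\<close> assms(2) by (intro mult_mono) auto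
        then show ?thesis by (simp add: q_def mult.commute)
      qed
    qed (use q B assms in auto)
    also have "\<dots> = C * \<bar>x - x0\<bar>^2" by (simp add: C_def power_mult_distrib)
    finally show ?thesis .
  next
    case False
    then have "bump \<delta> a c P m x = 0" by (auto simp: bump_def)
    moreover have "C \<ge> 0" using B assms by (simp add: C_def)
    ultimately show ?thesis by simp
  qed
  then show ?thesis by blast
qed

text \<open>
  The numerator of the derivative of \<open>P / Q ^ m * exp (- \<delta> / Q)\<close> over the
  denominator \<open>Q ^ (m + 2)\<close>, for \<open>Q = gap a c\<close>.
\<close>

definition bump_deriv_poly :: "real \<Rightarrow> real \<Rightarrow> real \<Rightarrow> real poly \<Rightarrow> nat \<Rightarrow> real poly" where
  "bump_deriv_poly \<delta> a c P m =
     pderiv P * gap a c ^ 2 - smult (real m) (P * pderiv (gap a c) * gap a c)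
       + smult \<delta> (P * pderiv (gap a c))"

lemma bump_has_derivative:
  assumes "\<delta> > 0"
  shows "(bump \<delta> a c P m has_real_derivative bump \<delta> a c (bump_deriv_poly \<delta> a c P m) (m + 2) x) (at x)"
proof (cases "a < x \<and> x < c")
  case True
  define Q where "Q = gap a c"
  define q where "q = poly Q x"
  have q: "q > 0" using True by (simp add: q_def Q_def)
  have "((\<lambda>x. poly P x / poly Q x ^ m * exp (- \<delta> / poly Q x)) has_real_derivative
      poly (bump_deriv_poly \<delta> a c P m) x / q ^ (m + 2) * exp (- \<delta> / q)) (at x)"
    (is "(?f has_real_derivative ?D) _")
  proof -
    have 1: "((\<lambda>x. poly P x / poly Q x ^ m) has_real_derivative
       (poly (pderiv P) x * q - real m * poly P x * poly (pderiv Q) x) / q ^ Suc m) (at x)"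
      using q unfolding q_def
      by (auto intro!: derivative_eq_intros simp: field_simps) (cases m; simp add: field_simps)
    have 2: "((\<lambda>x. exp (- \<delta> / poly Q x)) has_real_derivative
       (\<delta> * poly (pderiv Q) x / q ^ 2) * exp (- \<delta> / q)) (at x)"
      using q unfolding q_def
      by (auto intro!: derivative_eq_intros simp: field_simps power2_eq_square)
    have 3: "poly (bump_deriv_poly \<delta> a c P m) x = poly (pderiv P) x * q\<^sup>2
        - real m * (poly P x * poly (pderiv Q) x * q) + \<delta> * (poly P x * poly (pderiv Q) x)"
      by (simp add: bump_deriv_poly_def Q_def q_def power2_eq_square algebra_simps)
    show ?thesis
      unfolding 3 using q
      by (intro DERIV_cong[OF DERIV_mult[OF 1 2]])
        (simp add: q_def[symmetric] field_simps power2_eq_square)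
  qed
  moreover have "\<forall>\<^sub>F y in nhds x. ?f y = bump \<delta> a c P m y"
  proof -
    have "\<forall>\<^sub>F y in nhds x. y \<in> {a<..<c}"
      using True by (intro eventually_nhds_in_open) auto
    then show ?thesis by eventually_elim (simp add: bump_def Q_def)
  qed
  ultimately show ?thesis
    using True by (subst (asm) DERIV_cong_ev[OF refl _ refl]) (auto simp: bump_def q_def Q_def)
next
  case False
  then have "x \<le> a \<or> c \<le> x" by auto
  from bump_flat[OF assms this, of P m] obtain C
    where "\<And>y. \<bar>bump \<delta> a c P m y\<bar> \<le> C * \<bar>y - x\<bar>^2" by blast
  then have "(bump \<delta> a c P m has_real_derivative 0) (at x)"
    using False by (intro DERIV_zero_if_quadratically_flat[of _ _ C]) (auto simp: bump_def)
  moreover have "bump \<delta> a c P' m' x = 0" for P' m' using False by (auto simp: bump_def)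
  ultimately show ?thesis by simp
qed

definition box_bump ::
  "real \<Rightarrow> 'a::euclidean_space \<Rightarrow> 'a \<Rightarrow> ('a \<Rightarrow> real poly) \<Rightarrow> ('a \<Rightarrow> nat) \<Rightarrow> 'a \<Rightarrow> real" where
  "box_bump \<delta> a c P m x = (\<Prod>b\<in>Basis. bump \<delta> (a \<bullet> b) (c \<bullet> b) (P b) (m b) (x \<bullet> b))"

lemma box_bump_has_derivative:
  assumes "\<delta> > 0"
  shows "(box_bump \<delta> a c P m has_derivative (\<lambda>h. \<Sum>b\<in>Basis. (h \<bullet> b) *
     box_bump \<delta> a c (P(b := bump_deriv_poly \<delta> (a \<bullet> b) (c \<bullet> b) (P b) (m b))) (m(b := m b + 2)) x)) (at x)"
proof -
  define k where "k b = bump \<delta> (a \<bullet> b) (c \<bullet> b) (P b) (m b)" for b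
  define k' where "k' b = bump \<delta> (a \<bullet> b) (c \<bullet> b)
     (bump_deriv_poly \<delta> (a \<bullet> b) (c \<bullet> b) (P b) (m b)) (m b + 2)" for b
  have "((\<lambda>x. k b (x \<bullet> b)) has_derivative (\<lambda>h. k' b (x \<bullet> b) * (h \<bullet> b))) (at x)" for b
  proof -
    have "(k b has_derivative (\<lambda>h. k' b (x \<bullet> b) * h)) (at (x \<bullet> b))"
      using bump_has_derivative[OF assms] unfolding k_def k'_def has_field_derivative_def by blast
    from has_derivative_compose[OF has_derivative_inner_left[OF has_derivative_ident] this]
    show ?thesis by simp
  qed
  then have "((\<lambda>x. \<Prod>b\<in>Basis. k b (x \<bullet> b)) has_derivative
      (\<lambda>h. \<Sum>b\<in>Basis. k' b (x \<bullet> b) * (h \<bullet> b) * (\<Prod>j\<in>Basis - {b}. k j (x \<bullet> j)))) (at x)"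
    by (rule has_derivative_prod)
  moreover have "box_bump \<delta> a c (P(b := bump_deriv_poly \<delta> (a \<bullet> b) (c \<bullet> b) (P b) (m b))) (m(b := m b + 2)) x
      = k' b (x \<bullet> b) * (\<Prod>j\<in>Basis - {b}. k j (x \<bullet> j))" if "b \<in> Basis" for b
    unfolding box_bump_def using that
    by (subst prod.remove[OF _ that]) (auto simp: k_def k'_def intro!: prod.cong)
  ultimately show ?thesis
    unfolding box_bump_def[abs_def] k_def
    by (simp add: mult.assoc mult.left_commute cong: sum.cong)
qed

text \<open>
  A partial derivative changes the data of one factor of the product only, so the products stay
  within one family.
\<close>

lemma smooth_box_bump:
  assumes "\<delta> > 0"
  shows "smooth (box_bump \<delta> a c P m)"
proof (rule smooth_if_derivative_closed[where F = "{box_bump \<delta> a c P m | P m. True}"])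
  fix g x assume "g \<in> {box_bump \<delta> a c P m | P m. True}"
  then show "g differentiable (at x)"
    using box_bump_has_derivative[OF assms] by (force simp: differentiable_def)
next
  fix g b assume "g \<in> {box_bump \<delta> a c P m | P m. True}" and b: "b \<in> (Basis :: 'a set)"
  then obtain P m where g: "g = box_bump \<delta> a c P m" by blast
  have "dir_deriv b g = box_bump \<delta> a c (P(b := bump_deriv_poly \<delta> (a \<bullet> b) (c \<bullet> b) (P b) (m b))) (m(b := m b + 2))"
  proof
    fix x
    show "dir_deriv b g x = box_bump \<delta> a c (P(b := bump_deriv_poly \<delta> (a \<bullet> b) (c \<bullet> b) (P b) (m b))) (m(b := m b + 2)) x"
      unfolding dir_deriv_def g
      using frechet_derivative_at[OF box_bump_has_derivative[OF assms, of a c P m x], symmetric] b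
      by (simp add: inner_Basis if_distrib sum.delta if_distribR cong: if_cong)
  qed
  then show "dir_deriv b g \<in> {box_bump \<delta> a c P m | P m. True}" by blast
qed blast

lemma box_bump_nonzero_iff:
  "box_bump \<delta> a c (\<lambda>_. 1) m x \<noteq> 0 \<longleftrightarrow> x \<in> box a c"
  by (auto simp: box_bump_def bump_def mem_box)

lemma box_bump_test_function:
  assumes "\<delta> > 0" "cbox a c \<subseteq> \<Omega>"
  shows "box_bump \<delta> a c (\<lambda>_. 1) m \<in> test_functions \<Omega>"
proof -
  have "closure {x. box_bump \<delta> a c (\<lambda>_. 1) m x \<noteq> 0} \<subseteq> cbox a c"
    unfolding box_bump_nonzero_iff Collect_mem_eq by (intro closure_minimal box_subset_cbox closed_cbox)
  moreover from this have "bounded (closure {x. box_bump \<delta> a c (\<lambda>_. 1) m x \<noteq> 0})"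
    using bounded_cbox bounded_subset by blast
  ultimately show ?thesis
    using assms(2) smooth_box_bump[OF assms(1)]
    unfolding test_functions_def compact_eq_bounded_closed by auto
qed

lemma box_bump_le_indicator:
  assumes "\<delta> > 0"
  shows "\<bar>box_bump \<delta> a c (\<lambda>_. 1) (\<lambda>_. 0) x\<bar> \<le> indicator (box a c) x"
proof (cases "x \<in> box a c")
  case True
  then have "\<bar>box_bump \<delta> a c (\<lambda>_. 1) (\<lambda>_. 0) x\<bar> \<le> 1"
    unfolding box_bump_def abs_prod using assms by (intro prod_le_1) (auto simp: bump_def mem_box)
  then show ?thesis using True by simp
next
  case False
  then show ?thesis using box_bump_nonzero_iff[of \<delta> a c "\<lambda>_. 0" x] by auto
qed

text \<open>
  As \<open>\<delta>\<close> tends to zero, each exponential tends to one inside the box, while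
  the functions vanish outside throughout.
\<close>

lemma box_bump_tendsto_indicator:
  "(\<lambda>n. box_bump (1 / real (Suc n)) a c (\<lambda>_. 1) (\<lambda>_. 0) x) \<longlonglongrightarrow> indicator (box a c) x"
proof (cases "x \<in> box a c")
  case True
  have "(\<lambda>n. bump (1 / real (Suc n)) (a \<bullet> b) (c \<bullet> b) 1 0 (x \<bullet> b)) \<longlonglongrightarrow> 1" if "b \<in> Basis" for b
  proof -
    have "(\<lambda>n. exp (- (1 / real (Suc n)) / ((x \<bullet> b - a \<bullet> b) * (c \<bullet> b - x \<bullet> b)))) \<longlonglongrightarrow>
        exp (- 0 / ((x \<bullet> b - a \<bullet> b) * (c \<bullet> b - x \<bullet> b)))"
      using True that by (intro tendsto_intros LIMSEQ_inverse_real_of_nat[unfolded inverse_eq_divide]) (auto simp: mem_box)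
    then show ?thesis using True that by (simp add: bump_def mem_box)
  qed
  then have "(\<lambda>n. box_bump (1 / real (Suc n)) a c (\<lambda>_. 1) (\<lambda>_. 0) x) \<longlonglongrightarrow> (\<Prod>b\<in>(Basis::'a set). 1)"
    unfolding box_bump_def by (intro tendsto_prod) auto
  then show ?thesis using True by simp
next
  case False
  then have "box_bump \<delta> a c (\<lambda>_. 1) (\<lambda>_. 0) x = 0" for \<delta>
    using box_bump_nonzero_iff[of \<delta> a c "\<lambda>_. 0" x] by auto
  then show ?thesis using False by simp
qed

section \<open>The fundamental lemma of the calculus of variations\<close>

lemma continuous_on_iter_deriv:
  assumes "smooth f" "set is \<subseteq> Basis"
  shows "continuous_on S (iter_deriv is f)"
proof -
  have "iter_deriv is f differentiable (at x)" for x
    using assms by (auto simp: smooth_def lists_eq_set)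
  then show ?thesis
    by (intro continuous_at_imp_continuous_on ballI differentiable_imp_continuous_within)
qed

lemma iter_deriv_zero_off_support:
  assumes "x \<notin> closure {x. f x \<noteq> 0}"
  shows "iter_deriv is f x = 0"
  using assms
proof (induction "is" arbitrary: x)
  case Nil
  then show ?case using closure_subset[of "{x. f x \<noteq> 0}"] by (auto simp: iter_deriv_def)
next
  case (Cons v vs)
  have "(iter_deriv vs f has_derivative (\<lambda>h. 0)) (at x)"
  proof (rule has_derivative_transform_within_open[of "\<lambda>_. 0"])
    show "open (- closure {x. f x \<noteq> 0})" by (rule open_Compl[OF closed_closure])
  qed (use Cons in auto)
  then show ?case
    by (simp add: iter_deriv_def dir_deriv_def frechet_derivative_at[symmetric])
qed
lemma open_countable_cbox_cover:
  fixes \<Omega> :: "'a::euclidean_space set"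
  assumes "open \<Omega>"
  shows "\<exists>\<C>. countable \<C> \<and> (\<forall>K\<in>\<C>. K \<subseteq> \<Omega> \<and> (\<exists>a b. K = cbox a b)) \<and> \<Union>\<C> = \<Omega>"
proof -
  obtain \<D> where "countable \<D>" "\<D> \<subseteq> Pow \<Omega>" "\<And>X. X \<in> \<D> \<Longrightarrow> \<exists>a b. X = cbox a b" "\<Union>\<D> = \<Omega>"
    by (rule open_countable_Union_open_cbox[OF assms]) (rule that)
  then show ?thesis by (intro exI[of _ \<D>]) auto
qed

lemma locally_integrable_measurable:
  fixes \<Omega> :: "'a::euclidean_space set"
  assumes "open \<Omega>" "locally_integrable \<Omega> w"
  shows "w \<in> borel_measurable (lebesgue_on \<Omega>)"
proof -
  obtain \<C> :: "'a set set" where C: "countable \<C>"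
    "\<forall>K\<in>\<C>. K \<subseteq> \<Omega> \<and> (\<exists>a b. K = cbox a b)" "\<Union>\<C> = \<Omega>"
    using open_countable_cbox_cover[OF assms(1)] by blast
  show ?thesis
  proof (rule measurable_piecewise_restrict[OF C(1)])
    fix K assume K: "K \<in> \<C>"
    from bspec[OF C(2) K] have K': "K \<subseteq> \<Omega>" "compact K" by auto
    show "K \<inter> space (lebesgue_on \<Omega>) \<in> sets (lebesgue_on \<Omega>)"
      using K' compact_imp_closed[OF K'(2)] assms(1)
      by (subst sets_restrict_space_iff) (auto simp: Int_absorb2)
    have "w \<in> borel_measurable (lebesgue_on K)"
      using assms(2) K' by (simp add: locally_integrable_def borel_measurable_integrable)
    then show "w \<in> borel_measurable (restrict_space (lebesgue_on \<Omega>) K)"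
      using K' assms(1) compact_imp_closed[OF K'(2)]
      by (subst restrict_restrict_space) (auto simp: Int_absorb1)
  next
    show "space (lebesgue_on \<Omega>) \<subseteq> \<Union>\<C>" using C(3) by simp
  qed
qed

lemma integrable_lebesgue_on_subset_iff:
  fixes f :: "'a::euclidean_space \<Rightarrow> real"
  assumes "K \<in> sets lebesgue" "\<Omega> \<in> sets lebesgue" "K \<subseteq> \<Omega>" "\<And>x. x \<in> \<Omega> \<Longrightarrow> x \<notin> K \<Longrightarrow> f x = 0"
  shows "integrable (lebesgue_on \<Omega>) f \<longleftrightarrow> integrable (lebesgue_on K) f"
    and "integral\<^sup>L (lebesgue_on \<Omega>) f = integral\<^sup>L (lebesgue_on K) f"
proof -
  have "(\<lambda>x. indicator \<Omega> x *\<^sub>R f x) = (\<lambda>x. indicator K x *\<^sub>R f x)"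
    using assms(3,4) by (auto simp: indicator_def fun_eq_iff)
  then show "integrable (lebesgue_on \<Omega>) f \<longleftrightarrow> integrable (lebesgue_on K) f"
    and "integral\<^sup>L (lebesgue_on \<Omega>) f = integral\<^sup>L (lebesgue_on K) f"
    using assms(1,2) by (simp_all add: integrable_restrict_space integral_restrict_space)
qed

text \<open>
  The bumps tend boundedly to the indicator of the open box, so the hypothesis on test functions
  passes to the box by dominated convergence.
\<close>

lemma box_integral_zero:
  fixes \<Omega> :: "'a::euclidean_space set"
  assumes "open \<Omega>" "locally_integrable \<Omega> w"
    and zero: "\<And>\<phi>. \<phi> \<in> test_functions \<Omega> \<Longrightarrow> (LINT x|lebesgue_on \<Omega>. w x * \<phi> x) = 0"
    and sub: "cbox a c \<subseteq> \<Omega>"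
  shows "integral (cbox a c) w = 0"
proof -
  define \<phi> where "\<phi> n = box_bump (1 / real (Suc n)) a c (\<lambda>_. 1) (\<lambda>_. 0)" for n
  have int: "integrable (lebesgue_on (cbox a c)) w"
    using assms(2) sub by (auto simp: locally_integrable_def)
  have \<phi>: "\<phi> n \<in> test_functions \<Omega>" for n
    unfolding \<phi>_def by (intro box_bump_test_function sub) simp
  have cont: "continuous_on S (\<phi> n)" for n S
    using continuous_on_iter_deriv[of "\<phi> n" "[]"] \<phi>[of n] by (simp add: test_functions_def iter_deriv_def)
  have meas: "\<phi> n \<in> borel_measurable (lebesgue_on (cbox a c))" for n
    by (intro continuous_imp_measurable_on_sets_lebesgue cont) auto
  have "box a c \<in> sets (lebesgue_on (cbox a c))"
    using box_subset_cbox[of a c] by (subst sets_restrict_space_iff) auto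
  then have ind: "(\<lambda>x. w x * indicator (box a c) x) \<in> borel_measurable (lebesgue_on (cbox a c))"
    by (rule borel_measurable_times[OF borel_measurable_integrable[OF int] borel_measurable_indicator])
  have bd: "\<bar>\<phi> n x\<bar> \<le> indicator (box a c) x" for n x
    unfolding \<phi>_def by (rule box_bump_le_indicator) simp
  have "(LINT x|lebesgue_on (cbox a c). w x * \<phi> n x) = 0" for n
  proof -
    have "\<phi> n x = 0" if "x \<notin> cbox a c" for x
      using bd[of n x] that box_subset_cbox[of a c] by (cases "x \<in> box a c") auto
    then have "(LINT x|lebesgue_on \<Omega>. w x * \<phi> n x) = (LINT x|lebesgue_on (cbox a c). w x * \<phi> n x)"
      using sub assms(1) by (intro integrable_lebesgue_on_subset_iff(2)) auto
    then show ?thesis using zero[OF \<phi>[of n]] by simp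
  qed
  moreover have "(\<lambda>n. LINT x|lebesgue_on (cbox a c). w x * \<phi> n x)
      \<longlonglongrightarrow> (LINT x|lebesgue_on (cbox a c). w x * indicator (box a c) x)"
  proof (rule integral_dominated_convergence[where w = "\<lambda>x. \<bar>w x\<bar>"])
    show "(\<lambda>x. w x * indicator (box a c) x) \<in> borel_measurable (lebesgue_on (cbox a c))"
      by (rule ind)
    show "(\<lambda>x. w x * \<phi> n x) \<in> borel_measurable (lebesgue_on (cbox a c))" for n
      by (rule borel_measurable_times[OF borel_measurable_integrable[OF int] meas])
    show "AE x in lebesgue_on (cbox a c). (\<lambda>n. w x * \<phi> n x) \<longlonglongrightarrow> w x * indicator (box a c) x"
      unfolding \<phi>_def by (intro AE_I2 tendsto_intros box_bump_tendsto_indicator)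
    show "AE x in lebesgue_on (cbox a c). norm (w x * \<phi> n x) \<le> \<bar>w x\<bar>" for n
    proof (rule AE_I2)
      fix x
      have "\<bar>\<phi> n x\<bar> \<le> 1" using bd[of n x] by (rule order_trans) (simp add: indicator_def)
      then show "norm (w x * \<phi> n x) \<le> \<bar>w x\<bar>" by (simp add: abs_mult mult_left_le)
    qed
  qed (use int in auto)
  ultimately have "(LINT x|lebesgue_on (cbox a c). w x * indicator (box a c) x) = 0"
    by (simp add: LIMSEQ_const_iff)
  moreover have "(LINT x|lebesgue_on (cbox a c). w x * indicator (box a c) x) = (LINT x|lebesgue_on (cbox a c). w x)"
  proof (rule integral_cong_AE)
    have "negligible (cbox a c - box a c)"
      by (rule negligible_frontier_interval)
    then have "AE x in lebesgue. x \<notin> cbox a c - box a c"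
      by (intro AE_not_in) (simp add: negligible_iff_null_sets)
    then show "AE x in lebesgue_on (cbox a c). w x * indicator (box a c) x = w x"
      by (subst AE_restrict_space_iff) (simp, erule eventually_mono, auto simp: indicator_def)
    show "(\<lambda>x. w x * indicator (box a c) x) \<in> borel_measurable (lebesgue_on (cbox a c))"
      by (rule ind)
  qed (use int in auto)
  ultimately show ?thesis
    using lebesgue_integral_eq_integral[OF int] by simp
qed

text \<open>
  On a closed box inside \<open>\<Omega>\<close> all integrals over subboxes vanish, so by
  Lebesgue differentiation \<open>w\<close> vanishes almost everywhere there; countably many
  such boxes cover \<open>\<Omega>\<close>.
\<close>

lemma fundamental_lemma_calculus_of_variations:
  fixes \<Omega> :: "'a::euclidean_space set"
  assumes "open \<Omega>" "locally_integrable \<Omega> w"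
    and "\<And>\<phi>. \<phi> \<in> test_functions \<Omega> \<Longrightarrow> (LINT x|lebesgue_on \<Omega>. w x * \<phi> x) = 0"
  shows "AE x in lebesgue_on \<Omega>. w x = 0"
proof -
  have box: "negligible {x \<in> cbox a c. w x \<noteq> 0}" if sub: "cbox a c \<subseteq> \<Omega>" for a c
  proof -
    define f where "f x = (if x \<in> cbox a c then w x else 0)" for x
    have f0: "(f has_integral 0) (cbox u v)" for u v
    proof -
      obtain u' v' where uv: "cbox u v \<inter> cbox a c = cbox u' v'"
        using Int_interval by blast
      have "cbox u' v' \<subseteq> \<Omega>" using uv sub by blast
      then have "integrable (lebesgue_on (cbox u' v')) w"
        using assms(2) by (auto simp: locally_integrable_def)
      then have "w integrable_on cbox u' v'"
        by (intro integrable_on_lebesgue_on) auto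
      moreover have "integral (cbox u' v') w = 0"
        using \<open>cbox u' v' \<subseteq> \<Omega>\<close> by (intro box_integral_zero[OF assms(1,2) assms(3)])
      ultimately have "(w has_integral 0) (cbox u v \<inter> cbox a c)"
        unfolding uv by (metis integrable_integral)
      then show ?thesis
        unfolding f_def has_integral_restrict_Int by (simp add: Int_commute)
    qed
    then have "f integrable_on cbox u v" for u v by blast
    then obtain N where N: "negligible N" "\<And>x e. \<lbrakk>x \<notin> N; 0 < e\<rbrakk> \<Longrightarrow>
       \<exists>d>0. \<forall>h. 0 < h \<and> h < d \<longrightarrow>
         norm (integral (cbox x (x + h *\<^sub>R One)) f /\<^sub>R h ^ DIM('a) - f x) < e"
      by (rule integrable_ccontinuous_explicit) (rule that)
    have "f x = 0" if x: "x \<notin> N" for x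
    proof (rule ccontr)
      assume "f x \<noteq> 0"
      then obtain d where "d > 0" and d: "\<And>h. 0 < h \<Longrightarrow> h < d \<Longrightarrow>
          norm (integral (cbox x (x + h *\<^sub>R One)) f /\<^sub>R h ^ DIM('a) - f x) < \<bar>f x\<bar>"
        using N(2)[OF x, of "\<bar>f x\<bar>"] by auto
      moreover have "integral (cbox x (x + (d/2) *\<^sub>R One)) f = 0"
        using f0 by (rule integral_unique)
      ultimately show False using d[of "d/2"] by simp
    qed
    then have "{x \<in> cbox a c. w x \<noteq> 0} \<subseteq> N" by (force simp: f_def)
    then show ?thesis by (rule negligible_subset[OF N(1)])
  qed
  obtain \<C> :: "'a set set" where C: "countable \<C>"
    "\<forall>K\<in>\<C>. K \<subseteq> \<Omega> \<and> (\<exists>a b. K = cbox a b)" "\<Union>\<C> = \<Omega>"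
    using open_countable_cbox_cover[OF assms(1)] by blast
  have "negligible (\<Union>K\<in>\<C>. {x \<in> K. w x \<noteq> 0})"
  proof (rule negligible_countable_Union)
    show "countable ((\<lambda>K. {x \<in> K. w x \<noteq> 0}) ` \<C>)" using C(1) by (rule countable_image)
    fix A assume "A \<in> (\<lambda>K. {x \<in> K. w x \<noteq> 0}) ` \<C>"
    then obtain K where "K \<in> \<C>" "A = {x \<in> K. w x \<noteq> 0}" by blast
    then show "negligible A" using C(2) box by metis
  qed
  then have "AE x in lebesgue. x \<notin> (\<Union>K\<in>\<C>. {x \<in> K. w x \<noteq> 0})"
    by (intro AE_not_in) (simp add: negligible_iff_null_sets)
  then show ?thesis
    using assms(1) C(3) by (subst AE_restrict_space_iff) (simp, erule eventually_mono, auto)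
qed

section \<open>Seminormed spaces of functions\<close>

text \<open>
  Elements are functions rather than classes of functions, hence the value zero on nonzero
  functions is permitted.  Differences suffice as operation, because only distances matter.
\<close>

locale function_seminorm =
  fixes V :: "('a \<Rightarrow> real) set" and N :: "('a \<Rightarrow> real) \<Rightarrow> real"
  assumes zero_mem: "(\<lambda>_. 0) \<in> V"
    and diff_mem: "\<And>u v. u \<in> V \<Longrightarrow> v \<in> V \<Longrightarrow> u - v \<in> V"
    and zero: "N (\<lambda>_. 0) = 0"
    and nonneg: "\<And>u. 0 \<le> N u"
    and diff_le: "\<And>u v. u \<in> V \<Longrightarrow> v \<in> V \<Longrightarrow> N (u - v) \<le> N u + N v"
begin

lemma minus_commute: "u \<in> V \<Longrightarrow> v \<in> V \<Longrightarrow> N (u - v) = N (v - u)"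
  using diff_le[OF zero_mem diff_mem, of u v] diff_le[OF zero_mem diff_mem, of v u] zero
  by (simp add: fun_diff_def)

lemma diff_self [simp]: "N (u - u) = 0"
  using zero by (simp add: fun_diff_def)

lemma triangle: 
  assumes "u \<in> V" "v \<in> V" "w \<in> V"
  shows "N (u - w) \<le> N (u - v) + N (v - w)"
  using diff_le[of "u - v" "w - v"] assms diff_mem minus_commute[of v w] by (simp add: fun_diff_def)

lemma le_add_diff: "u \<in> V \<Longrightarrow> v \<in> V \<Longrightarrow> N u \<le> N v + N (u - v)"
  using triangle[of u v "\<lambda>_. 0"] zero_mem by (simp add: fun_diff_def)

text \<open>
  The increments are summed by a geometric series; keeping the term \<open>q ^ m\<close> makes
  the induction go through.
\<close>

lemma geometric_distance:
  assumes u: "\<And>n. u n \<in> V" and step: "\<And>n. N (u (Suc n) - u n) \<le> C * q ^ n"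
    and q: "0 \<le> q" "q < 1" and "n \<le> m"
  shows "N (u m - u n) \<le> C * q ^ n / (1 - q)"
proof -
  have "0 \<le> C" using order_trans[OF nonneg step[of 0]] by simp
  have "N (u m - u n) \<le> C * (q ^ n - q ^ m) / (1 - q)"
    using \<open>n \<le> m\<close>
  proof (induction m rule: dec_induct)
    case base
    then show ?case by (simp add: zero)
  next
    case (step m)
    have "N (u (Suc m) - u n) \<le> C * q ^ m + C * (q ^ n - q ^ m) / (1 - q)"
      using triangle[OF u u u, of "Suc m" n m] assms(2)[of m] step.IH by linarith
    also have "\<dots> = C * (q ^ n - q ^ Suc m) / (1 - q)"
      using q by (simp add: field_simps)
    finally show ?case .
  qed
  also have "\<dots> \<le> C * q ^ n / (1 - q)"
    using q \<open>0 \<le> C\<close> by (intro divide_right_mono mult_left_mono) auto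
  finally show ?thesis .
qed

end

section \<open>Lebesgue spaces\<close>

text \<open>
  Convexity of the power, applied to \<open>x + y = \<theta> * (x / \<theta>) + (1 - \<theta>) *
  (y / (1 - \<theta>))\<close>.  In this form the inequality can be integrated and summed before
  \<open>\<theta>\<close> is chosen.
\<close>

lemma powr_add_le_weighted:
  fixes x y \<theta> p :: real
  assumes "p \<ge> 1" "0 < \<theta>" "\<theta> < 1"
  shows "\<bar>x + y\<bar> powr p \<le> \<theta> powr (1 - p) * \<bar>x\<bar> powr p + (1 - \<theta>) powr (1 - p) * \<bar>y\<bar> powr p"
proof (cases "x = 0 \<or> y = 0")
  case True
  have "1 \<le> t powr (1 - p)" if "0 < t" "t < 1" for t
    using that assms powr_mono2'[of "p - 1" t 1] powr_mono2'[of "1 - p" t 1] by simp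
  from this[of \<theta>] this[of "1 - \<theta>"] True assms show ?thesis
    by (auto simp: mult_le_cancel_right1)
next
  case False
  have eq: "t * (s / t) powr p = t powr (1 - p) * s powr p" if "t > 0" "s > 0" for t s
    using that by (simp add: powr_divide powr_diff)
  have "\<bar>x + y\<bar> powr p \<le> (\<theta> * (\<bar>x\<bar> / \<theta>) + (1 - \<theta>) * (\<bar>y\<bar> / (1 - \<theta>))) powr p"
    using assms by (intro powr_mono2) (auto simp: abs_triangle_ineq)
  also have "\<dots> \<le> \<theta> * (\<bar>x\<bar> / \<theta>) powr p + (1 - \<theta>) * (\<bar>y\<bar> / (1 - \<theta>)) powr p"
    using convex_onD[OF powr_convex[OF assms(1)], of "1 - \<theta>" "\<bar>x\<bar> / \<theta>" "\<bar>y\<bar> / (1 - \<theta>)"] False assms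
    by simp
  also have "\<dots> = \<theta> powr (1 - p) * \<bar>x\<bar> powr p + (1 - \<theta>) powr (1 - p) * \<bar>y\<bar> powr p"
    using False assms by (subst (1 2) eq) auto
  finally show ?thesis .
qed

text \<open>
  Minkowski's inequality in abstract form.  For \<open>A\<close>, \<open>B\<close>,
  \<open>C\<close> the integrals of the \<open>p\<close>-th powers of two functions and of their
  sum, or finite sums of such integrals, the bound comes from the pointwise inequality above.
  The best \<open>\<theta>\<close> is the proportion of the two norms.
\<close>

lemma root_subadditive:
  fixes A B C p :: real
  assumes "p \<ge> 1" "0 \<le> A" "0 \<le> B" "0 \<le> C"
    and bound: "\<And>\<theta>. 0 < \<theta> \<Longrightarrow> \<theta> < 1 \<Longrightarrow> C \<le> \<theta> powr (1 - p) * A + (1 - \<theta>) powr (1 - p) * B"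
  shows "C powr (1 / p) \<le> A powr (1 / p) + B powr (1 / p)"
proof (rule field_le_epsilon)
  fix e :: real assume "e > 0"
  \<comment> \<open>The increase by \<open>e / 2\<close> keeps both weights positive if a norm vanishes.\<close>
  define a where "a = A powr (1 / p) + e / 2"
  define b where "b = B powr (1 / p) + e / 2"
  have pos: "a > 0" "b > 0" using \<open>e > 0\<close> by (auto simp: a_def b_def add_nonneg_pos)
  have "A = (A powr (1 / p)) powr p" "B = (B powr (1 / p)) powr p"
    using assms by (auto simp: powr_powr)
  then have AB: "A \<le> a powr p" "B \<le> b powr p"
    using assms(1) \<open>e > 0\<close>
    by (metis a_def b_def powr_mono2 powr_ge_zero less_add_same_cancel1 half_gt_zero less_imp_le order_trans zero_le_one)+
  have "C \<le> (a / (a + b)) powr (1 - p) * A + (1 - a / (a + b)) powr (1 - p) * B"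
    using pos by (intro bound) auto
  also have "1 - a / (a + b) = b / (a + b)" using pos by (simp add: field_simps)
  also have "(a / (a + b)) powr (1 - p) * A + (b / (a + b)) powr (1 - p) * B
      \<le> (a / (a + b)) powr (1 - p) * a powr p + (b / (a + b)) powr (1 - p) * b powr p"
    using AB by (intro add_mono mult_left_mono) auto
  also have "\<dots> = (a + b) powr p"
  proof -
    have "(t / s) powr (1 - p) * t powr p = t / s * s powr p" if "t > 0" "s > 0" for t s :: real
      using that by (simp add: powr_divide powr_diff field_simps)
    then show ?thesis using pos by (simp flip: distrib_right add_divide_distrib)
  qed
  finally have "C powr (1 / p) \<le> ((a + b) powr p) powr (1 / p)"
    using assms by (intro powr_mono2) auto
  also have "\<dots> = A powr (1 / p) + B powr (1 / p) + e"
    using pos assms(1) by (simp add: powr_powr) (simp add: a_def b_def)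
  finally show "C powr (1 / p) \<le> A powr (1 / p) + B powr (1 / p) + e" .
qed

lemma LpD:
  assumes "u \<in> Lp p \<Omega>"
  shows "u \<in> borel_measurable (lebesgue_on \<Omega>)" "integrable (lebesgue_on \<Omega>) (\<lambda>x. \<bar>u x\<bar> powr p)"
  using assms by (auto simp: Lp_def)

lemma Lp_diff_energy:
  assumes "p \<ge> 1" "u \<in> Lp p \<Omega>" "v \<in> Lp p \<Omega>"
  shows "u - v \<in> Lp p \<Omega>"
    and "0 < \<theta> \<Longrightarrow> \<theta> < 1 \<Longrightarrow> (LINT x|lebesgue_on \<Omega>. \<bar>(u - v) x\<bar> powr p) \<le>
      \<theta> powr (1 - p) * (LINT x|lebesgue_on \<Omega>. \<bar>u x\<bar> powr p)
      + (1 - \<theta>) powr (1 - p) * (LINT x|lebesgue_on \<Omega>. \<bar>v x\<bar> powr p)"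
proof -
  note [measurable] = LpD(1)[OF assms(2)] LpD(1)[OF assms(3)]
  note int = LpD(2)[OF assms(2)] LpD(2)[OF assms(3)]
  have bd: "\<bar>(u - v) x\<bar> powr p \<le> \<theta> powr (1 - p) * \<bar>u x\<bar> powr p + (1 - \<theta>) powr (1 - p) * \<bar>v x\<bar> powr p"
    if "0 < \<theta>" "\<theta> < 1" for x \<theta>
    using powr_add_le_weighted[OF assms(1) that, of "u x" "- v x"] by simp
  have meas: "u - v \<in> borel_measurable (lebesgue_on \<Omega>)"
    by (simp add: fun_diff_def)
  have "integrable (lebesgue_on \<Omega>) (\<lambda>x. \<bar>(u - v) x\<bar> powr p)"
  proof (rule Bochner_Integration.integrable_bound)
    show "integrable (lebesgue_on \<Omega>)
      (\<lambda>x. (1/2) powr (1 - p) * \<bar>u x\<bar> powr p + (1 - 1/2) powr (1 - p) * \<bar>v x\<bar> powr p)"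
      using int by auto
    show "AE x in lebesgue_on \<Omega>. norm (\<bar>(u - v) x\<bar> powr p) \<le> 
       norm ((1/2) powr (1 - p) * \<bar>u x\<bar> powr p + (1 - 1/2) powr (1 - p) * \<bar>v x\<bar> powr p)"
      using bd[of "1/2"] by (intro AE_I2) (simp add: order_trans[OF _ abs_ge_self])
    show "(\<lambda>x. \<bar>(u - v) x\<bar> powr p) \<in> borel_measurable (lebesgue_on \<Omega>)"
      using meas by measurable
  qed
  with meas show uv: "u - v \<in> Lp p \<Omega>" by (simp add: Lp_def)
  show "(LINT x|lebesgue_on \<Omega>. \<bar>(u - v) x\<bar> powr p) \<le>
      \<theta> powr (1 - p) * (LINT x|lebesgue_on \<Omega>. \<bar>u x\<bar> powr p)
      + (1 - \<theta>) powr (1 - p) * (LINT x|lebesgue_on \<Omega>. \<bar>v x\<bar> powr p)" if "0 < \<theta>" "\<theta> < 1"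
  proof -
    have "(LINT x|lebesgue_on \<Omega>. \<bar>(u - v) x\<bar> powr p) \<le>
      (LINT x|lebesgue_on \<Omega>. \<theta> powr (1 - p) * \<bar>u x\<bar> powr p + (1 - \<theta>) powr (1 - p) * \<bar>v x\<bar> powr p)"
      using int LpD(2)[OF uv] bd[OF that] by (intro integral_mono) auto
    then show ?thesis using int by simp
  qed
qed

lemma Lp_seminorm:
  assumes "p \<ge> 1"
  shows "function_seminorm (Lp p \<Omega>) (Lp_norm p \<Omega>)"
proof
  fix u v assume uv: "u \<in> Lp p \<Omega>" "v \<in> Lp p \<Omega>"
  show "u - v \<in> Lp p \<Omega>" using Lp_diff_energy(1)[OF assms uv] .
  show "Lp_norm p \<Omega> (u - v) \<le> Lp_norm p \<Omega> u + Lp_norm p \<Omega> v"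
    unfolding Lp_norm_def
    by (intro root_subadditive Lp_diff_energy(2)[OF assms uv] assms) (auto intro: integral_nonneg_AE)
qed (use assms in \<open>auto simp: Lp_def Lp_norm_def\<close>)

lemma Lp_norm_powr:
  assumes "p \<ge> 1"
  shows "Lp_norm p \<Omega> u powr p = (LINT x|lebesgue_on \<Omega>. \<bar>u x\<bar> powr p)"
proof -
  have "0 \<le> (LINT x|lebesgue_on \<Omega>. \<bar>u x\<bar> powr p)" by (rule integral_nonneg_AE) simp
  then show ?thesis using assms by (simp add: Lp_norm_def powr_powr)
qed

lemma Lp_norm_cong_AE:
  assumes "u \<in> borel_measurable (lebesgue_on \<Omega>)" "v \<in> borel_measurable (lebesgue_on \<Omega>)"
    and "AE x in lebesgue_on \<Omega>. u x = v x"
  shows "Lp_norm p \<Omega> u = Lp_norm p \<Omega> v"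
proof -
  note [measurable] = assms(1,2)
  have "(LINT x|lebesgue_on \<Omega>. \<bar>u x\<bar> powr p) = (LINT x|lebesgue_on \<Omega>. \<bar>v x\<bar> powr p)"
    using assms(3) by (intro integral_cong_AE) (auto elim: eventually_mono)
  then show ?thesis by (simp add: Lp_norm_def)
qed

lemma Lp_cong_AE:
  assumes "u \<in> borel_measurable (lebesgue_on \<Omega>)" "v \<in> Lp p \<Omega>"
    and "AE x in lebesgue_on \<Omega>. u x = v x"
  shows "u \<in> Lp p \<Omega>"
proof -
  note [measurable] = assms(1) LpD(1)[OF assms(2)]
  have "integrable (lebesgue_on \<Omega>) (\<lambda>x. \<bar>u x\<bar> powr p) \<longleftrightarrow> integrable (lebesgue_on \<Omega>) (\<lambda>x. \<bar>v x\<bar> powr p)"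
    using assms(3) by (intro integrable_cong_AE) (auto elim: eventually_mono)
  then show ?thesis using assms LpD(2)[OF assms(2)] by (simp add: Lp_def)
qed

lemma Lp_norm_eq_0_imp_AE:
  assumes "p \<ge> 1" "u \<in> Lp p \<Omega>" "Lp_norm p \<Omega> u = 0"
  shows "AE x in lebesgue_on \<Omega>. u x = 0"
proof -
  have "(LINT x|lebesgue_on \<Omega>. \<bar>u x\<bar> powr p) = 0"
    using Lp_norm_powr[OF assms(1), of \<Omega> u] assms by simp
  then have "AE x in lebesgue_on \<Omega>. \<bar>u x\<bar> powr p = 0"
    using LpD(2)[OF assms(2)] by (subst (asm) integral_nonneg_eq_0_iff_AE) auto
  then show ?thesis by (rule eventually_mono) simp
qed

text \<open>
  In place of Hoelder's inequality, a split at the level \<open>\<delta>\<close>: below it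
  \<open>\<bar>u x\<bar> \<le> \<delta>\<close>, and above it \<open>\<bar>u x\<bar> \<le>
  \<delta> powr (1 - p) * \<bar>u x\<bar> powr p\<close>.  The level is then taken down to the
  norm.
\<close>

lemma L1_le_Lp:
  assumes "p \<ge> 1" "finite_measure (lebesgue_on \<Omega>)" "u \<in> Lp p \<Omega>"
  shows "integrable (lebesgue_on \<Omega>) u"
    and "(LINT x|lebesgue_on \<Omega>. \<bar>u x\<bar>) \<le> (measure (lebesgue_on \<Omega>) (space (lebesgue_on \<Omega>)) + 1) * Lp_norm p \<Omega> u"
proof -
  interpret finite_measure "lebesgue_on \<Omega>" by fact
  let ?m = "measure (lebesgue_on \<Omega>) (space (lebesgue_on \<Omega>))"
  have bd: "\<bar>u x\<bar> \<le> \<delta> + \<delta> powr (1 - p) * \<bar>u x\<bar> powr p" if "\<delta> > 0" for \<delta> x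
  proof (cases "\<bar>u x\<bar> \<le> \<delta>")
    case False
    then have "\<delta> powr (p - 1) \<le> \<bar>u x\<bar> powr (p - 1)"
      using that assms by (intro powr_mono2) auto
    then have "\<bar>u x\<bar> * 1 \<le> \<bar>u x\<bar> * (\<bar>u x\<bar> powr (p - 1) / \<delta> powr (p - 1))"
      using that by (intro mult_left_mono) auto
    also have "\<dots> = \<delta> powr (1 - p) * \<bar>u x\<bar> powr p"
      using that False by (simp add: powr_diff)
    finally show ?thesis using that by simp
  qed (simp add: add_increasing2)
  have int: "integrable (lebesgue_on \<Omega>) (\<lambda>x. \<delta> + \<delta> powr (1 - p) * \<bar>u x\<bar> powr p)" for \<delta>
    using LpD(2)[OF assms(3)] by auto
  show intu: "integrable (lebesgue_on \<Omega>) u"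
    by (rule Bochner_Integration.integrable_bound[OF int[of 1] LpD(1)[OF assms(3)]])
      (use bd[of 1] in \<open>auto intro!: AE_I2 order_trans[OF _ abs_ge_self]\<close>)
  have "(LINT x|lebesgue_on \<Omega>. \<bar>u x\<bar>) \<le> (?m + 1) * \<delta>" if "\<delta> > Lp_norm p \<Omega> u" for \<delta>
  proof -
    have "\<delta> > 0" using that by (rule le_less_trans[rotated]) (simp add: Lp_norm_def)
    have "(LINT x|lebesgue_on \<Omega>. \<bar>u x\<bar>) \<le> (LINT x|lebesgue_on \<Omega>. \<delta> + \<delta> powr (1 - p) * \<bar>u x\<bar> powr p)"
      using int intu bd \<open>\<delta> > 0\<close> by (intro integral_mono) auto
    also have "\<dots> = \<delta> * ?m + \<delta> powr (1 - p) * Lp_norm p \<Omega> u powr p"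
      using LpD(2)[OF assms(3)] by (simp add: Lp_norm_powr[OF assms(1)])
    also have "\<dots> \<le> \<delta> * ?m + \<delta> powr (1 - p) * \<delta> powr p"
      using that assms(1) by (intro add_left_mono mult_left_mono powr_mono2) (auto simp: Lp_norm_def)
    also have "\<dots> = (?m + 1) * \<delta>"
      using \<open>\<delta> > 0\<close> by (simp add: algebra_simps flip: powr_add)
    finally show ?thesis .
  qed
  then have "(LINT x|lebesgue_on \<Omega>. \<bar>u x\<bar>) / (?m + 1) \<le> \<delta>" if "\<delta> > Lp_norm p \<Omega> u" for \<delta>
    using that by (simp add: divide_le_eq add_nonneg_pos mult.commute)
  then have "(LINT x|lebesgue_on \<Omega>. \<bar>u x\<bar>) / (?m + 1) \<le> Lp_norm p \<Omega> u"
    by (rule dense_ge)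
  then show "(LINT x|lebesgue_on \<Omega>. \<bar>u x\<bar>) \<le> (?m + 1) * Lp_norm p \<Omega> u"
    by (simp add: divide_le_eq add_nonneg_pos mult.commute)
qed

text \<open>
  Used to pass to the limit in the defining identity of weak derivatives and in the condition of
  zero mean.
\<close>

lemma Lp_convergence_imp_weak:
  assumes "p \<ge> 1" "finite_measure (lebesgue_on \<Omega>)" "\<And>n. u n \<in> Lp p \<Omega>" "l \<in> Lp p \<Omega>"
    and lim: "(\<lambda>n. Lp_norm p \<Omega> (u n - l)) \<longlonglongrightarrow> 0"
    and \<psi>: "\<psi> \<in> borel_measurable (lebesgue_on \<Omega>)" "\<And>x. \<bar>\<psi> x\<bar> \<le> B"
  shows "(\<lambda>n. LINT x|lebesgue_on \<Omega>. u n x * \<psi> x) \<longlonglongrightarrow> (LINT x|lebesgue_on \<Omega>. l x * \<psi> x)"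
proof -
  let ?m = "measure (lebesgue_on \<Omega>) (space (lebesgue_on \<Omega>))"
  have int: "integrable (lebesgue_on \<Omega>) (\<lambda>x. f x * \<psi> x)" if "f \<in> Lp p \<Omega>" for f
  proof (rule Bochner_Integration.integrable_bound)
    note [measurable] = \<psi>(1) LpD(1)[OF that]
    show "integrable (lebesgue_on \<Omega>) (\<lambda>x. B * f x)" using L1_le_Lp(1)[OF assms(1,2) that] by simp
    show "AE x in lebesgue_on \<Omega>. norm (f x * \<psi> x) \<le> norm (B * f x)"
      using \<psi>(2) by (intro AE_I2) (auto simp: abs_mult mult.commute intro!: mult_right_mono intro: order_trans[OF _ abs_ge_self])
    show "(\<lambda>x. f x * \<psi> x) \<in> borel_measurable (lebesgue_on \<Omega>)" by measurable
  qed
  have diff: "u n - l \<in> Lp p \<Omega>" for n using Lp_diff_energy(1) assms by blast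
  have "norm ((LINT x|lebesgue_on \<Omega>. u n x * \<psi> x) - (LINT x|lebesgue_on \<Omega>. l x * \<psi> x))
      \<le> B * ((?m + 1) * Lp_norm p \<Omega> (u n - l))" for n
  proof -
    have "(LINT x|lebesgue_on \<Omega>. u n x * \<psi> x) - (LINT x|lebesgue_on \<Omega>. l x * \<psi> x)
        = (LINT x|lebesgue_on \<Omega>. (u n - l) x * \<psi> x)"
      using int[OF assms(3)] int[OF assms(4)] by (simp add: left_diff_distrib)
    also have "norm \<dots> \<le> (LINT x|lebesgue_on \<Omega>. norm ((u n - l) x * \<psi> x))"
      by (rule integral_norm_bound)
    also have "\<dots> \<le> (LINT x|lebesgue_on \<Omega>. B * \<bar>(u n - l) x\<bar>)"
    proof (rule integral_mono)
      show "integrable (lebesgue_on \<Omega>) (\<lambda>x. norm ((u n - l) x * \<psi> x))"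
        using int[OF diff] by (rule integrable_norm)
      show "integrable (lebesgue_on \<Omega>) (\<lambda>x. B * \<bar>(u n - l) x\<bar>)"
        using integrable_abs[OF L1_le_Lp(1)[OF assms(1,2) diff[of n]]] by (rule integrable_mult_right)
      show "norm ((u n - l) x * \<psi> x) \<le> B * \<bar>(u n - l) x\<bar>" for x
        using \<psi>(2)[of x] by (simp add: abs_mult mult.commute mult_right_mono)
    qed
    also have "\<dots> \<le> B * ((?m + 1) * Lp_norm p \<Omega> (u n - l))"
      using L1_le_Lp(2)[OF assms(1,2) diff[of n]] order_trans[OF abs_ge_zero \<psi>(2)] by (simp add: mult_left_mono)
    finally show ?thesis .
  qed
  moreover have "(\<lambda>n. B * ((?m + 1) * Lp_norm p \<Omega> (u n - l))) \<longlonglongrightarrow> 0"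
    using tendsto_mult_right_zero[OF tendsto_mult_right_zero[OF lim]] by simp
  ultimately have "(\<lambda>n. (LINT x|lebesgue_on \<Omega>. u n x * \<psi> x) - (LINT x|lebesgue_on \<Omega>. l x * \<psi> x)) \<longlonglongrightarrow> 0"
    by (rule Lim_null_comparison[OF always_eventually[OF allI]])
  then show ?thesis by (rule LIM_zero_cancel)
qed

text \<open>
  By monotone convergence the sum of the series has a finite integral, so it is finite almost
  everywhere.
\<close>

lemma AE_summable_if_integrals_geometric:
  fixes f :: "nat \<Rightarrow> 'a \<Rightarrow> real"
  assumes int: "\<And>n. integrable M (f n)" and le: "\<And>n. (LINT x|M. \<bar>f n x\<bar>) \<le> C * q ^ n"
    and q: "0 \<le> q" "q < 1"
  shows "AE x in M. summable (\<lambda>n. \<bar>f n x\<bar>)"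
proof -
  note [measurable] = borel_measurable_integrable[OF int]
  have "C \<ge> 0" using order_trans[OF integral_nonneg_AE le[of 0]] by simp
  have "AE x in M. (\<Sum>n. ennreal \<bar>f n x\<bar>) \<noteq> \<infinity>"
  proof (rule nn_integral_PInf_AE)
    have "(\<integral>\<^sup>+x. (\<Sum>n. ennreal \<bar>f n x\<bar>) \<partial>M) = (\<Sum>n. \<integral>\<^sup>+x. ennreal \<bar>f n x\<bar> \<partial>M)"
      by (intro nn_integral_suminf) measurable
    also have "\<dots> = (\<Sum>n. ennreal (LINT x|M. \<bar>f n x\<bar>))"
      using int by (intro suminf_cong nn_integral_eq_integral) auto
    also have "\<dots> \<le> (\<Sum>n. ennreal (C * q ^ n))"
      by (intro suminf_le ennreal_leI le) auto
    also have "\<dots> < \<infinity>"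
    proof -
      have "summable (\<lambda>n. C * q ^ n)"
        using q by (intro summable_mult summable_geometric) auto
      then show ?thesis using q \<open>C \<ge> 0\<close> by (subst suminf_ennreal2) auto
    qed
    finally show "(\<integral>\<^sup>+x. (\<Sum>n. ennreal \<bar>f n x\<bar>) \<partial>M) \<noteq> \<infinity>" by simp
  qed measurable
  then show ?thesis
    by (rule eventually_mono) (intro summable_suminf_not_top, auto)
qed

text \<open>
  The increments are geometrically small also in \<open>L\<^sup>1\<close>, so the sequence
  converges almost everywhere; Fatou's lemma bounds the distance to the pointwise limit.
\<close>

lemma Lp_complete:
  assumes p: "p \<ge> 1" and fin: "finite_measure (lebesgue_on \<Omega>)"
    and u: "\<And>n. u n \<in> Lp p \<Omega>" and step: "\<And>n. Lp_norm p \<Omega> (u (Suc n) - u n) \<le> C * q ^ n"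
    and q: "0 \<le> q" "q < 1"
  shows "\<exists>l\<in>Lp p \<Omega>. (\<lambda>n. Lp_norm p \<Omega> (u n - l)) \<longlonglongrightarrow> 0"
proof -
  interpret function_seminorm "Lp p \<Omega>" "Lp_norm p \<Omega>" by (rule Lp_seminorm[OF p])
  let ?M = "lebesgue_on \<Omega>"
  let ?m = "measure (lebesgue_on \<Omega>) (space (lebesgue_on \<Omega>))"
  note [measurable] = LpD(1)[OF u]
  define d where "d n = u (Suc n) - u n" for n
  have d: "d n \<in> Lp p \<Omega>" for n unfolding d_def by (intro diff_mem u)
  note [measurable] = LpD(1)[OF d]
  have "AE x in ?M. summable (\<lambda>n. \<bar>d n x\<bar>)"
  proof (rule AE_summable_if_integrals_geometric[OF L1_le_Lp(1)[OF p fin d] _ q])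
    fix n
    have "(LINT x|?M. \<bar>d n x\<bar>) \<le> (?m + 1) * (C * q ^ n)"
      using L1_le_Lp(2)[OF p fin d[of n]] step[of n] unfolding d_def[of n, symmetric]
      by (rule order_trans[OF _ mult_left_mono]) simp
    then show "(LINT x|?M. \<bar>d n x\<bar>) \<le> (?m + 1) * C * q ^ n" by (simp add: mult.assoc)
  qed
  then have conv: "AE x in ?M. convergent (\<lambda>n. u n x)"
  proof (rule eventually_mono)
    fix x assume "summable (\<lambda>n. \<bar>d n x\<bar>)"
    then have "summable (\<lambda>n. d n x)" by (rule summable_rabs_cancel)
    then have "convergent (\<lambda>n. \<Sum>i<n. d i x)" by (simp add: summable_iff_convergent)
    then have "convergent (\<lambda>n. u 0 x + (\<Sum>i<n. d i x))" by (intro convergent_add convergent_const)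
    moreover have "u 0 x + (\<Sum>i<n. d i x) = u n x" for n
      unfolding d_def by (induction n) auto
    ultimately show "convergent (\<lambda>n. u n x)" by simp
  qed
  define l where "l x = lim (\<lambda>n. u n x)" for x
  have [measurable]: "l \<in> borel_measurable ?M" unfolding l_def by measurable
  have lim: "AE x in ?M. (\<lambda>n. u n x) \<longlonglongrightarrow> l x"
    using conv by (rule eventually_mono) (simp add: l_def convergent_LIMSEQ_iff)
  have nn: "(\<integral>\<^sup>+x. ennreal (\<bar>(u n - l) x\<bar> powr p) \<partial>?M) \<le> ennreal ((C * q ^ n / (1 - q)) powr p)" for n
  proof -
    have "(\<integral>\<^sup>+x. ennreal (\<bar>(u n - l) x\<bar> powr p) \<partial>?M)
        = (\<integral>\<^sup>+x. liminf (\<lambda>m. ennreal (\<bar>(u n - u m) x\<bar> powr p)) \<partial>?M)"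
    proof (rule nn_integral_cong_AE, use lim in \<open>rule eventually_mono\<close>)
      fix x assume "(\<lambda>m. u m x) \<longlonglongrightarrow> l x"
      then have "(\<lambda>m. ennreal (\<bar>(u n - u m) x\<bar> powr p)) \<longlonglongrightarrow> ennreal (\<bar>(u n - l) x\<bar> powr p)"
        using p unfolding minus_apply by (intro tendsto_ennrealI tendsto_powr' tendsto_intros) auto
      then show "ennreal (\<bar>(u n - l) x\<bar> powr p) = liminf (\<lambda>m. ennreal (\<bar>(u n - u m) x\<bar> powr p))"
        by (intro lim_imp_Liminf[symmetric]) auto
    qed
    also have "\<dots> \<le> liminf (\<lambda>m. \<integral>\<^sup>+x. ennreal (\<bar>(u n - u m) x\<bar> powr p) \<partial>?M)"
      by (intro nn_integral_liminf) (simp add: minus_apply)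
    also have "\<dots> \<le> ennreal ((C * q ^ n / (1 - q)) powr p)"
    proof (rule Liminf_le)
      show "\<forall>\<^sub>F m in sequentially. (\<integral>\<^sup>+x. ennreal (\<bar>(u n - u m) x\<bar> powr p) \<partial>?M) \<le> ennreal ((C * q ^ n / (1 - q)) powr p)"
        using eventually_ge_at_top[of n]
      proof eventually_elim
        case (elim m)
        have "Lp_norm p \<Omega> (u n - u m) \<le> C * q ^ n / (1 - q)"
          using geometric_distance[OF u step q elim] minus_commute[OF u u] by simp
        then have "Lp_norm p \<Omega> (u n - u m) powr p \<le> (C * q ^ n / (1 - q)) powr p"
          using p nonneg by (intro powr_mono2) auto
        then show ?case
          using LpD(2)[OF diff_mem[OF u u]] p
          by (subst nn_integral_eq_integral) (auto simp: Lp_norm_powr intro!: ennreal_leI)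
      qed
    qed simp
    finally show ?thesis .
  qed
  have mem: "u n - l \<in> Lp p \<Omega>" for n
  proof -
    have "integrable ?M (\<lambda>x. \<bar>(u n - l) x\<bar> powr p)"
      using nn[of n] by (intro integrableI_bounded) (auto simp: minus_apply intro: le_less_trans)
    moreover have "u n - l \<in> borel_measurable ?M" by (simp add: fun_diff_def)
    ultimately show ?thesis by (simp add: Lp_def)
  qed
  have le: "Lp_norm p \<Omega> (u n - l) \<le> C * q ^ n / (1 - q)" for n
  proof -
    have nonneg': "0 \<le> C * q ^ n / (1 - q)" using geometric_distance[OF u step q order_refl, of n] nonneg order_trans by blast
    have "(LINT x|?M. \<bar>(u n - l) x\<bar> powr p) \<le> (C * q ^ n / (1 - q)) powr p"
      using nn[of n] LpD(2)[OF mem[of n]] by (subst (asm) nn_integral_eq_integral) auto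
    then have "Lp_norm p \<Omega> (u n - l) \<le> ((C * q ^ n / (1 - q)) powr p) powr (1 / p)"
      unfolding Lp_norm_def using p by (intro powr_mono2) (auto intro: integral_nonneg_AE)
    also have "\<dots> = C * q ^ n / (1 - q)"
      unfolding powr_powr using p powr_one[OF nonneg'] by simp
    finally show ?thesis .
  qed
  have "l \<in> Lp p \<Omega>" using diff_mem[OF u mem[of 0], of 0] by (simp add: fun_diff_def)
  moreover have "(\<lambda>n. Lp_norm p \<Omega> (u n - l)) \<longlonglongrightarrow> 0"
  proof (rule Lim_null_comparison)
    show "\<forall>\<^sub>F n in sequentially. norm (Lp_norm p \<Omega> (u n - l)) \<le> C * q ^ n / (1 - q)"
      using le nonneg by simp
    show "(\<lambda>n. C * q ^ n / (1 - q)) \<longlonglongrightarrow> 0"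
      using q by (intro tendsto_divide_zero tendsto_mult_right_zero LIMSEQ_realpow_zero) auto
  qed
  ultimately show ?thesis by blast
qed

section \<open>Sobolev spaces\<close>

lemma test_function_iter_deriv_bounded:
  assumes "\<phi> \<in> test_functions \<Omega>" "set is \<subseteq> Basis"
  obtains B where "\<And>x. \<bar>iter_deriv is \<phi> x\<bar> \<le> B"
proof -
  let ?K = "closure {x. \<phi> x \<noteq> 0}"
  have "compact ?K" "smooth \<phi>" using assms(1) by (auto simp: test_functions_def)
  then have "bounded (iter_deriv is \<phi> ` ?K)"
    by (intro compact_imp_bounded compact_continuous_image continuous_on_iter_deriv assms(2))
  then obtain B where B: "B > 0" "\<And>x. x \<in> ?K \<Longrightarrow> \<bar>iter_deriv is \<phi> x\<bar> \<le> B"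
    unfolding bounded_pos by fastforce
  have "\<bar>iter_deriv is \<phi> x\<bar> \<le> B" for x
    using B iter_deriv_zero_off_support[of x \<phi> "is"] by (cases "x \<in> ?K") auto
  then show ?thesis by (rule that)
qed

lemma test_function_iter_deriv_measurable:
  assumes "\<phi> \<in> test_functions \<Omega>" "set is \<subseteq> Basis" "S \<in> sets lebesgue"
  shows "iter_deriv is \<phi> \<in> borel_measurable (lebesgue_on S)"
  using assms
  by (intro continuous_imp_measurable_on_sets_lebesgue continuous_on_iter_deriv) (auto simp: test_functions_def)

text \<open>
  A locally integrable function need not be integrable on \<open>\<Omega>\<close>; the compact
  support of the test function makes the product so.
\<close>

lemma integrable_mult_test_function:
  fixes \<Omega> :: "'a::euclidean_space set"
  assumes "open \<Omega>" "locally_integrable \<Omega> w" "\<phi> \<in> test_functions \<Omega>" "set is \<subseteq> Basis"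
  shows "integrable (lebesgue_on \<Omega>) (\<lambda>x. w x * iter_deriv is \<phi> x)"
proof -
  let ?K = "closure {x. \<phi> x \<noteq> 0}"
  have K: "compact ?K" "?K \<subseteq> \<Omega>" "?K \<in> sets lebesgue"
    using assms(3) by (auto simp: test_functions_def)
  obtain B where B: "\<And>x. \<bar>iter_deriv is \<phi> x\<bar> \<le> B"
    using test_function_iter_deriv_bounded[OF assms(3,4)] by blast
  have w: "integrable (lebesgue_on ?K) w"
    using assms(2) K by (simp add: locally_integrable_def)
  have "integrable (lebesgue_on ?K) (\<lambda>x. w x * iter_deriv is \<phi> x)"
  proof (rule Bochner_Integration.integrable_bound)
    show "integrable (lebesgue_on ?K) (\<lambda>x. B * w x)" using w by simp
    show "(\<lambda>x. w x * iter_deriv is \<phi> x) \<in> borel_measurable (lebesgue_on ?K)"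
      using borel_measurable_integrable[OF w] test_function_iter_deriv_measurable[OF assms(3,4) K(3)]
      by (rule borel_measurable_times)
    show "AE x in lebesgue_on ?K. norm (w x * iter_deriv is \<phi> x) \<le> norm (B * w x)"
    proof (rule AE_I2)
      fix x
      have "\<bar>iter_deriv is \<phi> x\<bar> \<le> \<bar>B\<bar>" using B[of x] by simp
      then show "norm (w x * iter_deriv is \<phi> x) \<le> norm (B * w x)"
        using mult_left_mono[of "\<bar>iter_deriv is \<phi> x\<bar>" "\<bar>B\<bar>" "\<bar>w x\<bar>"] by (simp add: abs_mult mult.commute)
    qed
  qed
  then show ?thesis
    using K assms(1) iter_deriv_zero_off_support
    by (subst integrable_lebesgue_on_subset_iff(1)[of ?K]) auto
qed

lemma locally_integrable_diff:
  assumes "locally_integrable \<Omega> u" "locally_integrable \<Omega> v"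
  shows "locally_integrable \<Omega> (u - v)"
  using assms by (auto simp: locally_integrable_def fun_diff_def)

lemma has_weak_deriv_diff:
  fixes \<Omega> :: "'a::euclidean_space set"
  assumes "open \<Omega>" "set is \<subseteq> Basis" "has_weak_deriv \<Omega> is u v" "has_weak_deriv \<Omega> is u' v'"
  shows "has_weak_deriv \<Omega> is (u - u') (v - v')"
  unfolding has_weak_deriv_def
proof (intro conjI ballI)
  fix \<phi> :: "'a \<Rightarrow> real" assume \<phi>: "\<phi> \<in> test_functions \<Omega>"
  have loc: "locally_integrable \<Omega> u" "locally_integrable \<Omega> u'" "locally_integrable \<Omega> v" "locally_integrable \<Omega> v'"
    using assms by (auto simp: has_weak_deriv_def)
  note int = integrable_mult_test_function[OF assms(1) loc(1) \<phi> assms(2)]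
    integrable_mult_test_function[OF assms(1) loc(2) \<phi> assms(2)]
    integrable_mult_test_function[OF assms(1) loc(3) \<phi>, of "[]"]
    integrable_mult_test_function[OF assms(1) loc(4) \<phi>, of "[]"]
  show "(LINT x|lebesgue_on \<Omega>. (u - u') x * iter_deriv is \<phi> x)
      = (- 1) ^ length is * (LINT x|lebesgue_on \<Omega>. (v - v') x * \<phi> x)"
    using int assms(3,4) \<phi> by (simp add: has_weak_deriv_def left_diff_distrib iter_deriv_def right_diff_distrib)
qed (use assms in \<open>auto simp: has_weak_deriv_def intro: locally_integrable_diff\<close>)

lemma has_weak_deriv_AE_unique:
  fixes \<Omega> :: "'a::euclidean_space set"
  assumes "open \<Omega>" "has_weak_deriv \<Omega> is u v" "has_weak_deriv \<Omega> is u v'"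
  shows "AE x in lebesgue_on \<Omega>. v x = v' x"
proof -
  have loc: "locally_integrable \<Omega> v" "locally_integrable \<Omega> v'"
    using assms by (auto simp: has_weak_deriv_def)
  have "AE x in lebesgue_on \<Omega>. (v - v') x = 0"
  proof (rule fundamental_lemma_calculus_of_variations[OF assms(1) locally_integrable_diff[OF loc]])
    fix \<phi> :: "'a \<Rightarrow> real" assume \<phi>: "\<phi> \<in> test_functions \<Omega>"
    have "(LINT x|lebesgue_on \<Omega>. v x * \<phi> x) = (LINT x|lebesgue_on \<Omega>. v' x * \<phi> x)"
      using assms(2,3) \<phi> by (simp add: has_weak_deriv_def)
    then show "(LINT x|lebesgue_on \<Omega>. (v - v') x * \<phi> x) = 0"
      using integrable_mult_test_function[OF assms(1) loc(1) \<phi>, of "[]"]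
        integrable_mult_test_function[OF assms(1) loc(2) \<phi>, of "[]"]
      by (simp add: left_diff_distrib iter_deriv_def)
  qed
  then show ?thesis by simp
qed

lemma has_weak_deriv_Nil_self: "locally_integrable \<Omega> u \<Longrightarrow> has_weak_deriv \<Omega> [] u u"
  by (simp add: has_weak_deriv_def iter_deriv_def)

lemma finite_deriv_indices: "finite (deriv_indices k :: 'a::euclidean_space list set)"
  unfolding deriv_indices_def by (rule finite_lists_length_le) simp

lemma Nil_in_deriv_indices [simp]: "[] \<in> deriv_indices k"
  by (simp add: deriv_indices_def)

locale sobolev_domain =
  fixes \<Omega> :: "'a::euclidean_space set" and p :: real
  assumes open_domain: "open \<Omega>" and finite_measure_domain: "finite_measure (lebesgue_on \<Omega>)"
    and one_le_p: "1 \<le> p"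
begin

lemma Lp_locally_integrable:
  assumes "u \<in> Lp p \<Omega>"
  shows "locally_integrable \<Omega> u"
  unfolding locally_integrable_def
proof (intro allI impI, elim conjE)
  fix K assume K: "compact K" "K \<subseteq> \<Omega>"
  have sets: "\<Omega> \<in> sets lebesgue" "K \<in> sets lebesgue" 
    using open_domain compact_imp_closed[OF K(1)] by auto
  have "integrable (lebesgue_on \<Omega>) (\<lambda>x. indicator K x *\<^sub>R u x)"
    using L1_le_Lp(1)[OF one_le_p finite_measure_domain assms] K sets
    by (intro integrable_mult_indicator) (auto simp: sets_restrict_space_iff)
  then have "integrable lebesgue (\<lambda>x. indicator \<Omega> x *\<^sub>R (indicator K x *\<^sub>R u x))"
    using sets by (subst (asm) integrable_restrict_space) auto
  also have "(\<lambda>x. indicator \<Omega> x *\<^sub>R (indicator K x *\<^sub>R u x)) = (\<lambda>x. indicator K x *\<^sub>R u x)"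
    using K by (auto simp: indicator_def fun_eq_iff)
  finally show "integrable (lebesgue_on K) u"
    using sets by (subst integrable_restrict_space) auto
qed

text \<open>
  The choice made by \<open>weak_deriv\<close> agrees almost everywhere with the derivative in
  \<open>L\<^sup>p\<close> that exists by membership, and so inherits its integrability.
\<close>

lemma weak_deriv_Lp:
  assumes "u \<in> Sobolev k p \<Omega>" "is \<in> deriv_indices k"
  shows "has_weak_deriv \<Omega> is u (weak_deriv \<Omega> is u)" "weak_deriv \<Omega> is u \<in> Lp p \<Omega>"
proof -
  obtain v where v: "v \<in> Lp p \<Omega>" "has_weak_deriv \<Omega> is u v"
    using assms by (auto simp: Sobolev_def)
  show D: "has_weak_deriv \<Omega> is u (weak_deriv \<Omega> is u)"
    unfolding weak_deriv_def by (rule someI[of "has_weak_deriv \<Omega> is u", OF v(2)])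
  have "locally_integrable \<Omega> (weak_deriv \<Omega> is u)" using D by (simp add: has_weak_deriv_def)
  then show "weak_deriv \<Omega> is u \<in> Lp p \<Omega>"
    by (rule Lp_cong_AE[OF locally_integrable_measurable[OF open_domain] v(1)
          has_weak_deriv_AE_unique[OF open_domain D v(2)]])
qed

text \<open>
  Membership speaks of weak derivatives only; that the function itself lies in
  \<open>L\<^sup>p\<close> follows because the derivative of order zero is the function, almost
  everywhere.
\<close>

lemma Sobolev_subset_Lp:
  assumes "u \<in> Sobolev k p \<Omega>"
  shows "u \<in> Lp p \<Omega>" "AE x in lebesgue_on \<Omega>. weak_deriv \<Omega> [] u x = u x"
proof -
  note D = weak_deriv_Lp[OF assms, of "[]", simplified]
  have u: "locally_integrable \<Omega> u" using D by (simp add: has_weak_deriv_def)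
  show ae: "AE x in lebesgue_on \<Omega>. weak_deriv \<Omega> [] u x = u x"
    using has_weak_deriv_AE_unique[OF open_domain D(1) has_weak_deriv_Nil_self[OF u]] .
  show "u \<in> Lp p \<Omega>"
  proof (rule Lp_cong_AE[OF locally_integrable_measurable[OF open_domain u] D(2)])
    show "AE x in lebesgue_on \<Omega>. u x = weak_deriv \<Omega> [] u x" using ae by (rule eventually_mono) simp
  qed
qed

lemma Sobolev_diff:
  assumes "u \<in> Sobolev k p \<Omega>" "v \<in> Sobolev k p \<Omega>"
  shows "u - v \<in> Sobolev k p \<Omega>"
    and "is \<in> deriv_indices k \<Longrightarrow>
      AE x in lebesgue_on \<Omega>. weak_deriv \<Omega> is (u - v) x = (weak_deriv \<Omega> is u - weak_deriv \<Omega> is v) x"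
proof -
  have D: "has_weak_deriv \<Omega> is (u - v) (weak_deriv \<Omega> is u - weak_deriv \<Omega> is v)"
    if "is \<in> deriv_indices k" for "is"
    by (rule has_weak_deriv_diff[OF open_domain _ weak_deriv_Lp(1)[OF assms(1) that] weak_deriv_Lp(1)[OF assms(2) that]])
      (use that in \<open>simp add: deriv_indices_def\<close>)
  show uv: "u - v \<in> Sobolev k p \<Omega>"
    unfolding Sobolev_def
    using D Lp_diff_energy(1)[OF one_le_p weak_deriv_Lp(2)[OF assms(1)] weak_deriv_Lp(2)[OF assms(2)]]
    by blast
  show "AE x in lebesgue_on \<Omega>. weak_deriv \<Omega> is (u - v) x = (weak_deriv \<Omega> is u - weak_deriv \<Omega> is v) x"
    if "is \<in> deriv_indices k"
    by (rule has_weak_deriv_AE_unique[OF open_domain weak_deriv_Lp(1)[OF uv that] D[OF that]])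
qed

lemma Lp_norm_weak_deriv_diff:
  assumes "u \<in> Sobolev k p \<Omega>" "v \<in> Sobolev k p \<Omega>" "is \<in> deriv_indices k"
  shows "Lp_norm p \<Omega> (weak_deriv \<Omega> is (u - v)) = Lp_norm p \<Omega> (weak_deriv \<Omega> is u - weak_deriv \<Omega> is v)"
proof (rule Lp_norm_cong_AE)
  show "weak_deriv \<Omega> is (u - v) \<in> borel_measurable (lebesgue_on \<Omega>)"
    by (rule LpD(1)[OF weak_deriv_Lp(2)[OF Sobolev_diff(1)[OF assms(1,2)] assms(3)]])
  show "weak_deriv \<Omega> is u - weak_deriv \<Omega> is v \<in> borel_measurable (lebesgue_on \<Omega>)"
    by (rule LpD(1)[OF Lp_diff_energy(1)[OF one_le_p weak_deriv_Lp(2)[OF assms(1,3)] weak_deriv_Lp(2)[OF assms(2,3)]]])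
  show "AE x in lebesgue_on \<Omega>. weak_deriv \<Omega> is (u - v) x = (weak_deriv \<Omega> is u - weak_deriv \<Omega> is v) x"
    by (rule Sobolev_diff(2)[OF assms])
qed

lemma Lp_norm_weak_deriv_le:
  fixes "is" :: "'a list"
  assumes "is \<in> deriv_indices k"
  shows "Lp_norm p \<Omega> (weak_deriv \<Omega> is u) \<le> Sobolev_norm k p \<Omega> u"
proof -
  have "Lp_norm p \<Omega> (weak_deriv \<Omega> is u) powr p \<le> (\<Sum>is\<in>deriv_indices k. Lp_norm p \<Omega> (weak_deriv \<Omega> is u) powr p)"
    using assms finite_deriv_indices
    by (intro member_le_sum[where f = "\<lambda>is. Lp_norm p \<Omega> (weak_deriv \<Omega> is u) powr p"]) simp_all
  then have "(Lp_norm p \<Omega> (weak_deriv \<Omega> is u) powr p) powr (1 / p) \<le> Sobolev_norm k p \<Omega> u"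
    unfolding Sobolev_norm_def using one_le_p by (intro powr_mono2) auto
  moreover have "0 \<le> Lp_norm p \<Omega> (weak_deriv \<Omega> is u)" by (simp add: Lp_norm_def)
  ultimately show ?thesis using one_le_p by (simp add: powr_powr)
qed

lemma Lp_norm_le_Sobolev_norm:
  assumes "u \<in> Sobolev k p \<Omega>"
  shows "Lp_norm p \<Omega> u \<le> Sobolev_norm k p \<Omega> u"
proof -
  have "Lp_norm p \<Omega> u = Lp_norm p \<Omega> (weak_deriv \<Omega> [] u)"
  proof (rule Lp_norm_cong_AE[OF LpD(1)[OF Sobolev_subset_Lp(1)[OF assms]]])
    show "weak_deriv \<Omega> [] u \<in> borel_measurable (lebesgue_on \<Omega>)"
      by (rule LpD(1)[OF weak_deriv_Lp(2)[OF assms]]) simp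
    show "AE x in lebesgue_on \<Omega>. u x = weak_deriv \<Omega> [] u x"
      using Sobolev_subset_Lp(2)[OF assms] by (rule eventually_mono) simp
  qed
  then show ?thesis using Lp_norm_weak_deriv_le[of "[]" k u] by simp
qed

lemma Sobolev_norm_AE_zero:
  assumes "u \<in> Lp p \<Omega>" "AE x in lebesgue_on \<Omega>. u x = 0"
  shows "u \<in> Sobolev k p \<Omega>" "Sobolev_norm k p \<Omega> u = 0"
proof -
  have D: "has_weak_deriv \<Omega> is u (\<lambda>_. 0)" if "is \<in> deriv_indices k" for "is"
    unfolding has_weak_deriv_def
  proof (intro conjI ballI)
    show "locally_integrable \<Omega> u" by (rule Lp_locally_integrable[OF assms(1)])
    fix \<phi> :: "'a \<Rightarrow> real" assume \<phi>: "\<phi> \<in> test_functions \<Omega>"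
    have "(LINT x|lebesgue_on \<Omega>. u x * iter_deriv is \<phi> x) = 0"
    proof (rule integral_eq_zero_AE)
      show "AE x in lebesgue_on \<Omega>. u x * iter_deriv is \<phi> x = 0"
        using assms(2) by (rule eventually_mono) simp
    qed
    then show "(LINT x|lebesgue_on \<Omega>. u x * iter_deriv is \<phi> x)
       = (- 1) ^ length is * (LINT x|lebesgue_on \<Omega>. 0 * \<phi> x)" by simp
  qed (simp add: locally_integrable_def)
  have Z: "(\<lambda>_. 0) \<in> Lp p \<Omega>" using one_le_p by (simp add: Lp_def)
  show u: "u \<in> Sobolev k p \<Omega>" using D Z by (auto simp: Sobolev_def)
  have "Lp_norm p \<Omega> (weak_deriv \<Omega> is u) = 0" if "is \<in> deriv_indices k" for "is"
  proof -
    have "Lp_norm p \<Omega> (weak_deriv \<Omega> is u) = Lp_norm p \<Omega> (\<lambda>_. 0)"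
      using has_weak_deriv_AE_unique[OF open_domain weak_deriv_Lp(1)[OF u that] D[OF that]]
        LpD(1)[OF weak_deriv_Lp(2)[OF u that]]
      by (intro Lp_norm_cong_AE) auto
    then show ?thesis using one_le_p by (simp add: Lp_norm_def)
  qed
  then show "Sobolev_norm k p \<Omega> u = 0" using one_le_p by (simp add: Sobolev_norm_def)
qed

text \<open>
  The energy is summed over the derivatives before the root is taken, so one application of
  Minkowski's inequality in abstract form suffices.
\<close>

lemma Sobolev_seminorm: "function_seminorm (Sobolev k p \<Omega>) (Sobolev_norm k p \<Omega>)"
proof
  have Z: "(\<lambda>_. 0) \<in> Lp p \<Omega>" using one_le_p by (simp add: Lp_def)
  show "(\<lambda>_. 0) \<in> Sobolev k p \<Omega>" "Sobolev_norm k p \<Omega> (\<lambda>_. 0) = 0"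
    using Sobolev_norm_AE_zero[OF Z] by auto
  show "0 \<le> Sobolev_norm k p \<Omega> u" for u by (simp add: Sobolev_norm_def)
  fix u v assume uv: "u \<in> Sobolev k p \<Omega>" "v \<in> Sobolev k p \<Omega>"
  show "u - v \<in> Sobolev k p \<Omega>" using Sobolev_diff[OF uv] by blast
  define A where "A w is = (LINT x|lebesgue_on \<Omega>. \<bar>weak_deriv \<Omega> is w x\<bar> powr p)" for w "is"
  have norm: "Sobolev_norm k p \<Omega> w = (\<Sum>is\<in>deriv_indices k. A w is) powr (1 / p)" for w
    unfolding Sobolev_norm_def A_def Lp_norm_powr[OF one_le_p] ..
  have A_nonneg: "0 \<le> A w is" for w "is" unfolding A_def by (rule integral_nonneg_AE) simp
  have *: "A (u - v) is \<le> \<theta> powr (1 - p) * A u is + (1 - \<theta>) powr (1 - p) * A v is"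
    if "is \<in> deriv_indices k" "0 < \<theta>" "\<theta> < 1" for "is" \<theta>
  proof -
    have "A (u - v) is = (LINT x|lebesgue_on \<Omega>. \<bar>(weak_deriv \<Omega> is u - weak_deriv \<Omega> is v) x\<bar> powr p)"
      using Lp_norm_weak_deriv_diff[OF uv that(1)] unfolding A_def by (simp only: Lp_norm_powr[OF one_le_p, symmetric])
    also have "\<dots> \<le> \<theta> powr (1 - p) * A u is + (1 - \<theta>) powr (1 - p) * A v is"
      unfolding A_def
      by (rule Lp_diff_energy(2)[OF one_le_p weak_deriv_Lp(2)[OF uv(1) that(1)] weak_deriv_Lp(2)[OF uv(2) that(1)] that(2,3)])
    finally show ?thesis .
  qed
  show "Sobolev_norm k p \<Omega> (u - v) \<le> Sobolev_norm k p \<Omega> u + Sobolev_norm k p \<Omega> v"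
    unfolding norm
  proof (rule root_subadditive[OF one_le_p])
    fix \<theta> :: real assume "0 < \<theta>" "\<theta> < 1"
    then have "(\<Sum>is\<in>deriv_indices k. A (u - v) is) \<le>
        (\<Sum>is\<in>deriv_indices k. \<theta> powr (1 - p) * A u is + (1 - \<theta>) powr (1 - p) * A v is)"
      by (intro sum_mono *)
    then show "(\<Sum>is\<in>deriv_indices k. A (u - v) is) \<le>
        \<theta> powr (1 - p) * (\<Sum>is\<in>deriv_indices k. A u is) + (1 - \<theta>) powr (1 - p) * (\<Sum>is\<in>deriv_indices k. A v is)"
      by (simp add: sum.distrib sum_distrib_left)
  qed (auto intro: sum_nonneg A_nonneg)
qed

text \<open>
  Every derivative converges in \<open>L\<^sup>p\<close>.  The limit of the derivatives of order
  zero has the other limits as weak derivatives, since both sides of the defining identity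
  converge for each test function.
\<close>

lemma Sobolev_complete:
  assumes u: "\<And>n. u n \<in> Sobolev k p \<Omega>"
    and step: "\<And>n. Sobolev_norm k p \<Omega> (u (Suc n) - u n) \<le> C * q ^ n"
    and q: "0 \<le> q" "q < 1"
  shows "\<exists>l\<in>Sobolev k p \<Omega>. (\<lambda>n. Sobolev_norm k p \<Omega> (u n - l)) \<longlonglongrightarrow> 0"
proof -
  have "\<exists>l\<in>Lp p \<Omega>. (\<lambda>n. Lp_norm p \<Omega> (weak_deriv \<Omega> is (u n) - l)) \<longlonglongrightarrow> 0" if "is \<in> deriv_indices k" for "is"
  proof (rule Lp_complete[OF one_le_p finite_measure_domain _ _ q])
    show "weak_deriv \<Omega> is (u n) \<in> Lp p \<Omega>" for n using weak_deriv_Lp(2)[OF u that] .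
    show "Lp_norm p \<Omega> (weak_deriv \<Omega> is (u (Suc n)) - weak_deriv \<Omega> is (u n)) \<le> C * q ^ n" for n
      using order_trans[OF Lp_norm_weak_deriv_le[OF that] step] 
      by (simp add: Lp_norm_weak_deriv_diff[OF u u that, symmetric])
  qed
  then obtain L where L: "\<And>is. is \<in> deriv_indices k \<Longrightarrow> L is \<in> Lp p \<Omega>"
    "\<And>is. is \<in> deriv_indices k \<Longrightarrow> (\<lambda>n. Lp_norm p \<Omega> (weak_deriv \<Omega> is (u n) - L is)) \<longlonglongrightarrow> 0"
    by metis
  define l where "l = L []"
  have l: "l \<in> Lp p \<Omega>" using L(1)[of "[]"] by (simp add: l_def)
  have D: "has_weak_deriv \<Omega> is l (L is)" if "is": "is \<in> deriv_indices k" for "is"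
    unfolding has_weak_deriv_def
  proof (intro conjI ballI)
    show "locally_integrable \<Omega> l" "locally_integrable \<Omega> (L is)"
      using Lp_locally_integrable l L(1)[OF that] by auto
    fix \<phi> :: "'a \<Rightarrow> real" assume \<phi>: "\<phi> \<in> test_functions \<Omega>"
    have basis: "set is \<subseteq> Basis" using that by (simp add: deriv_indices_def)
    have \<Omega>: "\<Omega> \<in> sets lebesgue" using open_domain by auto
    have pairing: "(\<lambda>n. LINT x|lebesgue_on \<Omega>. weak_deriv \<Omega> js (u n) x * iter_deriv ks \<phi> x)
        \<longlonglongrightarrow> (LINT x|lebesgue_on \<Omega>. L js x * iter_deriv ks \<phi> x)"
      if js: "js \<in> deriv_indices k" and ks: "set ks \<subseteq> Basis" for js ks
    proof -
      obtain B where "\<And>x. \<bar>iter_deriv ks \<phi> x\<bar> \<le> B"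
        using test_function_iter_deriv_bounded[OF \<phi> ks] by blast
      then show ?thesis
        using weak_deriv_Lp(2)[OF u js] L[OF js] test_function_iter_deriv_measurable[OF \<phi> ks \<Omega>]
        by (intro Lp_convergence_imp_weak[OF one_le_p finite_measure_domain]) auto
    qed
    have eq: "(LINT x|lebesgue_on \<Omega>. weak_deriv \<Omega> [] (u n) x * iter_deriv is \<phi> x)
        = (- 1) ^ length is * (LINT x|lebesgue_on \<Omega>. weak_deriv \<Omega> is (u n) x * iter_deriv [] \<phi> x)" for n
    proof -
      have "(LINT x|lebesgue_on \<Omega>. weak_deriv \<Omega> [] (u n) x * iter_deriv is \<phi> x)
          = (LINT x|lebesgue_on \<Omega>. u n x * iter_deriv is \<phi> x)"
      proof (rule integral_cong_AE)
        note m = test_function_iter_deriv_measurable[OF \<phi> basis \<Omega>]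
        show "(\<lambda>x. weak_deriv \<Omega> [] (u n) x * iter_deriv is \<phi> x) \<in> borel_measurable (lebesgue_on \<Omega>)"
          by (rule borel_measurable_times[OF LpD(1)[OF weak_deriv_Lp(2)[OF u]] m]) simp
        show "(\<lambda>x. u n x * iter_deriv is \<phi> x) \<in> borel_measurable (lebesgue_on \<Omega>)"
          by (rule borel_measurable_times[OF LpD(1)[OF Sobolev_subset_Lp(1)[OF u]] m])
        show "AE x in lebesgue_on \<Omega>. weak_deriv \<Omega> [] (u n) x * iter_deriv is \<phi> x = u n x * iter_deriv is \<phi> x"
          using Sobolev_subset_Lp(2)[OF u[of n]] by (rule eventually_mono) simp
      qed
      also have "\<dots> = (- 1) ^ length is * (LINT x|lebesgue_on \<Omega>. weak_deriv \<Omega> is (u n) x * \<phi> x)"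
        using weak_deriv_Lp(1)[OF u[of n] that] \<phi> by (simp add: has_weak_deriv_def)
      finally show ?thesis by (simp add: iter_deriv_def)
    qed
    have "(\<lambda>n. LINT x|lebesgue_on \<Omega>. weak_deriv \<Omega> [] (u n) x * iter_deriv is \<phi> x)
        \<longlonglongrightarrow> (- 1) ^ length is * (LINT x|lebesgue_on \<Omega>. L is x * iter_deriv [] \<phi> x)"
      unfolding eq by (intro tendsto_mult_left pairing that) simp
    moreover have "(\<lambda>n. LINT x|lebesgue_on \<Omega>. weak_deriv \<Omega> [] (u n) x * iter_deriv is \<phi> x)
        \<longlonglongrightarrow> (LINT x|lebesgue_on \<Omega>. l x * iter_deriv is \<phi> x)"
      unfolding l_def by (intro pairing basis) simp
    ultimately have "(LINT x|lebesgue_on \<Omega>. l x * iter_deriv is \<phi> x)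
        = (- 1) ^ length is * (LINT x|lebesgue_on \<Omega>. L is x * iter_deriv [] \<phi> x)"
      using LIMSEQ_unique by blast
    then show "(LINT x|lebesgue_on \<Omega>. l x * iter_deriv is \<phi> x)
        = (- 1) ^ length is * (LINT x|lebesgue_on \<Omega>. L is x * \<phi> x)" by (simp add: iter_deriv_def)
  qed
  have lS: "l \<in> Sobolev k p \<Omega>" using D L(1) by (auto simp: Sobolev_def)
  have conv: "(\<lambda>n. Lp_norm p \<Omega> (weak_deriv \<Omega> is (u n - l))) \<longlonglongrightarrow> 0" if "is": "is \<in> deriv_indices k" for "is"
  proof -
    have "Lp_norm p \<Omega> (weak_deriv \<Omega> is (u n - l)) = Lp_norm p \<Omega> (weak_deriv \<Omega> is (u n) - L is)" for n
    proof (rule Lp_norm_cong_AE)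
      show "weak_deriv \<Omega> is (u n - l) \<in> borel_measurable (lebesgue_on \<Omega>)"
        using weak_deriv_Lp(2)[OF Sobolev_diff(1)[OF u lS] that] by (rule LpD(1))
      show "weak_deriv \<Omega> is (u n) - L is \<in> borel_measurable (lebesgue_on \<Omega>)"
        using Lp_diff_energy(1)[OF one_le_p weak_deriv_Lp(2)[OF u that] L(1)[OF that]] by (rule LpD(1))
      have "has_weak_deriv \<Omega> is (u n - l) (weak_deriv \<Omega> is (u n) - L is)"
        by (rule has_weak_deriv_diff[OF open_domain _ weak_deriv_Lp(1)[OF u that] D[OF that]])
          (use that in \<open>simp add: deriv_indices_def\<close>)
      then show "AE x in lebesgue_on \<Omega>. weak_deriv \<Omega> is (u n - l) x = (weak_deriv \<Omega> is (u n) - L is) x"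
        by (rule has_weak_deriv_AE_unique[OF open_domain weak_deriv_Lp(1)[OF Sobolev_diff(1)[OF u lS] that]])
    qed
    then show ?thesis using L(2)[OF that] by simp
  qed
  have Lp_nonneg: "0 \<le> Lp_norm p \<Omega> f" for f by (simp add: Lp_norm_def)
  have "(\<lambda>n. \<Sum>is\<in>deriv_indices k. Lp_norm p \<Omega> (weak_deriv \<Omega> is (u n - l)) powr p)
      \<longlonglongrightarrow> (\<Sum>is\<in>(deriv_indices k :: 'a list set). 0 powr p)"
    using one_le_p Lp_nonneg by (intro tendsto_sum tendsto_powr' conv tendsto_const) auto
  then have "(\<lambda>n. Sobolev_norm k p \<Omega> (u n - l)) \<longlonglongrightarrow> (\<Sum>is\<in>(deriv_indices k :: 'a list set). 0 powr p) powr (1 / p)"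
    unfolding Sobolev_norm_def using one_le_p
    by (intro tendsto_powr' tendsto_const) (auto intro!: always_eventually sum_nonneg)
  then show ?thesis using lS one_le_p by auto
qed

end

section \<open>Essentially bounded functions of time\<close>

lemma Linf_time_norm_le:
  assumes "0 \<le> C" "AE t in lebesgue_on {0<..<T}. N (u t) \<le> C"
  shows "Linf_time_norm T N u \<le> C"
  unfolding Linf_time_norm_def using assms by (intro cInf_lower) (auto intro: bdd_belowI)

text \<open>
  The infimum is attained: the bounds that exceed it by \<open>1 / (n + 1)\<close> each hold
  almost everywhere, hence all of them together.
\<close>

lemma 
  assumes "AE t in lebesgue_on {0<..<T}. N (u t) \<le> C"
  shows Linf_time_norm_nonneg: "0 \<le> Linf_time_norm T N u"
    and Linf_time_norm_AE: "AE t in lebesgue_on {0<..<T}. N (u t) \<le> Linf_time_norm T N u"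
proof -
  let ?S = "{C. 0 \<le> C \<and> (AE t in lebesgue_on {0<..<T}. N (u t) \<le> C)}"
  have "AE t in lebesgue_on {0<..<T}. N (u t) \<le> max C 0"
    using assms by (rule eventually_mono) simp
  then have ne: "?S \<noteq> {}" by (auto intro!: exI[of _ "max C 0"])
  then show "0 \<le> Linf_time_norm T N u"
    unfolding Linf_time_norm_def by (intro cInf_greatest) auto
  have "AE t in lebesgue_on {0<..<T}. N (u t) \<le> Linf_time_norm T N u + 1 / real (Suc n)" for n
  proof -
    have "Inf ?S < Linf_time_norm T N u + 1 / real (Suc n)" by (simp add: Linf_time_norm_def)
    then obtain D where "D \<in> ?S" "D < Linf_time_norm T N u + 1 / real (Suc n)"
      using cInf_lessD[OF ne] by blast
    then have "AE t in lebesgue_on {0<..<T}. N (u t) \<le> D" by blast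
    then show ?thesis by (rule eventually_mono) (use \<open>D < _\<close> in simp)
  qed
  then have "AE t in lebesgue_on {0<..<T}. \<forall>n. N (u t) \<le> Linf_time_norm T N u + 1 / real (Suc n)"
    by (simp only: AE_all_countable) simp
  then show "AE t in lebesgue_on {0<..<T}. N (u t) \<le> Linf_time_norm T N u"
  proof (rule eventually_mono)
    fix t assume *: "\<forall>n. N (u t) \<le> Linf_time_norm T N u + 1 / real (Suc n)"
    have "(\<lambda>n. Linf_time_norm T N u + 1 / real (Suc n)) \<longlonglongrightarrow> Linf_time_norm T N u + 0"
      by (intro tendsto_intros LIMSEQ_inverse_real_of_nat[unfolded inverse_eq_divide])
    then show "N (u t) \<le> Linf_time_norm T N u"
      using * by (intro LIMSEQ_le_const) auto
  qed
qed

context function_seminorm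
begin

lemma diff_perturbation:
  assumes "u \<in> V" "v \<in> V" "w \<in> V"
  shows "\<bar>N (u - v) - N (u - w)\<bar> \<le> N (v - w)"
  using triangle[OF assms(1,2,3)] triangle[OF assms(1,3,2)] minus_commute[OF assms(2,3)] by linarith

lemma Linf_diff_AE:
  assumes "u \<in> Linf_time T V N" "v \<in> Linf_time T V N"
  shows "AE t in lebesgue_on {0<..<T}. u t \<in> V \<and> v t \<in> V \<and> N ((u - v) t) \<le> Linf_time_norm T N (u - v)"
    and "0 \<le> Linf_time_norm T N (u - v)"
proof -
  obtain C D where "AE t in lebesgue_on {0<..<T}. N (u t) \<le> C" "AE t in lebesgue_on {0<..<T}. N (v t) \<le> D"
    and mem: "AE t in lebesgue_on {0<..<T}. u t \<in> V" "AE t in lebesgue_on {0<..<T}. v t \<in> V"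
    using assms by (auto simp: Linf_time_def)
  then have "AE t in lebesgue_on {0<..<T}. N ((u - v) t) \<le> C + D"
  proof eventually_elim
    case (elim t)
    then show ?case using diff_le[of "u t" "v t"] by simp
  qed
  note bd = Linf_time_norm_AE[where N = N and u = "u - v", OF this]
    Linf_time_norm_nonneg[where N = N and u = "u - v", OF this]
  show "0 \<le> Linf_time_norm T N (u - v)" by (rule bd)
  show "AE t in lebesgue_on {0<..<T}. u t \<in> V \<and> v t \<in> V \<and> N ((u - v) t) \<le> Linf_time_norm T N (u - v)"
    using bd(1) mem by eventually_elim auto
qed

lemma Linf_triangle:
  assumes "u \<in> Linf_time T V N" "v \<in> Linf_time T V N" "w \<in> Linf_time T V N"
  shows "Linf_time_norm T N (u - w) \<le> Linf_time_norm T N (u - v) + Linf_time_norm T N (v - w)"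
proof (rule Linf_time_norm_le)
  show "0 \<le> Linf_time_norm T N (u - v) + Linf_time_norm T N (v - w)"
    using Linf_diff_AE(2) assms by simp
  show "AE t in lebesgue_on {0<..<T}. N ((u - w) t) \<le> Linf_time_norm T N (u - v) + Linf_time_norm T N (v - w)"
    using Linf_diff_AE(1)[OF assms(1,2)] Linf_diff_AE(1)[OF assms(2,3)]
  proof eventually_elim
    case (elim t)
    then show ?case using triangle[of "u t" "v t" "w t"] by simp
  qed
qed

lemma Linf_minus_commute:
  assumes "u \<in> Linf_time T V N" "v \<in> Linf_time T V N"
  shows "Linf_time_norm T N (u - v) = Linf_time_norm T N (v - u)"
proof -
  have "Linf_time_norm T N (u - v) \<le> Linf_time_norm T N (v - u)"
    if "u \<in> Linf_time T V N" "v \<in> Linf_time T V N" for u v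
  proof (rule Linf_time_norm_le)
    show "0 \<le> Linf_time_norm T N (v - u)" using Linf_diff_AE(2) that by blast
    show "AE t in lebesgue_on {0<..<T}. N ((u - v) t) \<le> Linf_time_norm T N (v - u)"
      using Linf_diff_AE(1)[OF that(2,1)] 
    proof eventually_elim
      case (elim t)
      then show ?case using minus_commute[of "u t" "v t"] by simp
    qed
  qed
  from this[OF assms] this[OF assms(2,1)] show ?thesis by simp
qed

text \<open>
  The simple functions converge almost everywhere.  Truncating the distance at one gives
  convergence of its integral by dominated convergence, hence smallness in mean.  The function
  \<open>f\<close> represents the truncated distance almost everywhere and is measurable by
  construction.
\<close>

lemma strongly_measurable_simple_approximation:
  assumes u: "strongly_measurable T V N u" "AE t in lebesgue_on {0<..<T}. u t \<in> V" and e: "e > 0"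
  shows "\<exists>s f. simple_function (lebesgue_on {0<..<T}) s \<and> s ` {0<..<T} \<subseteq> V \<and>
     integrable (lebesgue_on {0<..<T}) f \<and> (LINT t|lebesgue_on {0<..<T}. \<bar>f t\<bar>) \<le> e \<and>
     (AE t in lebesgue_on {0<..<T}. f t = min 1 (N (s t - u t)))"
proof -
  let ?M = "lebesgue_on {0<..<T}"
  interpret finite_measure ?M
    by (rule finite_measure_lebesgue_on) simp
  obtain s where s: "\<And>n. simple_function ?M (s n)" "\<And>n. s n ` {0<..<T} \<subseteq> V"
    and conv: "AE t in ?M. (\<lambda>n. N (s n t - u t)) \<longlonglongrightarrow> 0"
    using u(1) unfolding strongly_measurable_def by blast
  have sV: "AE t in ?M. \<forall>n. s n t \<in> V"
    using s(2) by (intro AE_I2) (auto simp: image_subset_iff)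
  \<comment> \<open>The limit over \<open>j\<close> is measurable, and agrees with \<open>N (s k t - u t)\<close> almost everywhere.\<close>
  define f where "f k t = min 1 (lim (\<lambda>j. N (s k t - s j t)))" for k t
  have [measurable]: "(\<lambda>t. N (s k t - s j t)) \<in> borel_measurable ?M" for k j
    using simple_function_compose2[OF s(1)[of k] s(1)[of j], of "\<lambda>a b. N (a - b)"]
    by (rule borel_measurable_simple_function)
  have [measurable]: "f k \<in> borel_measurable ?M" for k
    unfolding f_def by measurable
  have f: "AE t in ?M. \<forall>k. f k t = min 1 (N (s k t - u t))"
    using conv sV u(2)
  proof eventually_elim
    case (elim t)
    have "(\<lambda>j. N (s k t - s j t)) \<longlonglongrightarrow> N (s k t - u t)" for k
      using elim diff_perturbation
      by (intro LIM_zero_cancel[OF Lim_null_comparison[OF always_eventually elim(1)]]) auto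
    then have "lim (\<lambda>j. N (s k t - s j t)) = N (s k t - u t)" for k by (rule limI)
    then show ?case by (simp add: f_def)
  qed
  have bd: "AE t in ?M. norm (f k t) \<le> 1" for k
    using f
  proof (rule eventually_mono)
    fix t assume "\<forall>k. f k t = min 1 (N (s k t - u t))"
    then have "f k t = min 1 (N (s k t - u t))" by (rule spec)
    then show "norm (f k t) \<le> 1" using nonneg[of "s k t - u t"] by (simp add: min_def)
  qed
  have int: "integrable ?M (f k)" for k
    by (rule Bochner_Integration.integrable_bound[of _ "\<lambda>_. 1 :: real"]) (use bd[of k] in simp_all)
  have "(\<lambda>k. LINT t|?M. \<bar>f k t\<bar>) \<longlonglongrightarrow> (LINT t|?M. 0)"
  proof (rule integral_dominated_convergence[where w = "\<lambda>_. 1"])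
    show "AE t in ?M. (\<lambda>k. \<bar>f k t\<bar>) \<longlonglongrightarrow> 0"
      using f conv
    proof eventually_elim
      case (elim t)
      then have "(\<lambda>k. \<bar>min 1 (N (s k t - u t))\<bar>) \<longlonglongrightarrow> \<bar>min 1 0\<bar>"
        by (intro tendsto_rabs tendsto_min tendsto_const)
      then show ?case using elim by simp
    qed
  qed (use bd in simp_all)
  then have "\<forall>\<^sub>F k in sequentially. (LINT t|?M. \<bar>f k t\<bar>) < e"
    using e by (intro order_tendstoD(2)[of _ 0]) auto
  then obtain k where "(LINT t|?M. \<bar>f k t\<bar>) < e" by (auto simp: eventually_sequentially)
  then show ?thesis
  proof (intro exI[of _ "s k"] exI[of _ "f k"] conjI)
    show "AE t in ?M. f k t = min 1 (N (s k t - u t))" using f by (rule eventually_mono) simp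
  qed (use s int in auto)
qed

text \<open>
  A diagonal choice: the \<open>n\<close>-th simple function is within \<open>(1/2) ^ n\<close>
  of \<open>u n\<close> in mean, so these distances are summable and tend to zero almost
  everywhere.
\<close>

lemma strongly_measurable_limit:
  assumes u: "\<And>n. strongly_measurable T V N (u n)" "AE t in lebesgue_on {0<..<T}. \<forall>n. u n t \<in> V"
    and l: "AE t in lebesgue_on {0<..<T}. l t \<in> V"
    and lim: "AE t in lebesgue_on {0<..<T}. (\<lambda>n. N (u n t - l t)) \<longlonglongrightarrow> 0"
  shows "strongly_measurable T V N l"
proof -
  let ?M = "lebesgue_on {0<..<T}"
  define Q where "Q n s f \<longleftrightarrow> simple_function ?M s \<and> s ` {0<..<T} \<subseteq> V \<and>
     integrable ?M f \<and> (LINT t|?M. \<bar>f t\<bar>) \<le> (1/2) ^ n \<and>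
     (AE t in ?M. f t = min 1 (N (s t - u n t)))" for n s f
  have "\<exists>s f. Q n s f" for n
  proof -
    have "AE t in ?M. u n t \<in> V" using u(2) by (rule eventually_mono) simp
    from strongly_measurable_simple_approximation[OF u(1) this, of "(1/2) ^ n"] show ?thesis
      by (simp add: Q_def)
  qed
  then obtain s f where "\<And>n. Q n (s n) (f n)" by metis
  then have s: "\<And>n. simple_function ?M (s n)" "\<And>n. s n ` {0<..<T} \<subseteq> V"
    and f: "\<And>n. integrable ?M (f n)" "\<And>n. (LINT t|?M. \<bar>f n t\<bar>) \<le> 1 * (1/2) ^ n"
      "\<And>n. AE t in ?M. f n t = min 1 (N (s n t - u n t))"
    by (simp_all add: Q_def)
  have sV: "AE t in ?M. \<forall>n. s n t \<in> V"
    using s(2) by (intro AE_I2) (auto simp: image_subset_iff)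
  have "AE t in ?M. summable (\<lambda>n. \<bar>f n t\<bar>)"
    by (rule AE_summable_if_integrals_geometric[OF f(1,2)]) auto
  moreover have "AE t in ?M. \<forall>n. f n t = min 1 (N (s n t - u n t))"
    using f(3) by (simp add: AE_all_countable)
  ultimately have "AE t in ?M. (\<lambda>n. N (s n t - l t)) \<longlonglongrightarrow> 0"
    using sV u(2) l lim
  proof eventually_elim
    case (elim t)
    have f0: "(\<lambda>n. \<bar>f n t\<bar>) \<longlonglongrightarrow> 0" using elim(1) by (rule summable_LIMSEQ_zero)
    then have "\<forall>\<^sub>F n in sequentially. \<bar>f n t\<bar> < 1" by (rule order_tendstoD) simp
    then have "\<forall>\<^sub>F n in sequentially. norm (N (s n t - l t)) \<le> \<bar>f n t\<bar> + N (u n t - l t)"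
    proof eventually_elim
      case (elim n)
      then have "\<bar>f n t\<bar> = N (s n t - u n t)"
        using \<open>\<forall>n. f n t = min 1 (N (s n t - u n t))\<close> nonneg[of "s n t - u n t"]
        by (auto simp: min_def split: if_splits)
      then show ?case
        using triangle[of "s n t" "u n t" "l t"] \<open>\<forall>n. s n t \<in> V\<close> \<open>\<forall>n. u n t \<in> V\<close> \<open>l t \<in> V\<close> nonneg
        by simp
    qed
    moreover have "(\<lambda>n. \<bar>f n t\<bar> + N (u n t - l t)) \<longlonglongrightarrow> 0"
      using tendsto_add[OF f0 elim(6)] by simp
    ultimately show ?case by (rule Lim_null_comparison)
  qed
  then show ?thesis using s unfolding strongly_measurable_def by blast
qed

end

locale complete_function_seminorm = function_seminorm +
  assumes geometric_complete: "\<And>u C q. (\<And>n. u n \<in> V) \<Longrightarrow> (\<And>n. N (u (Suc n) - u n) \<le> C * q ^ n) \<Longrightarrow>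
    0 \<le> q \<Longrightarrow> q < 1 \<Longrightarrow> \<exists>l\<in>V. (\<lambda>n. N (u n - l)) \<longlonglongrightarrow> 0"
begin

text \<open>
  At almost every time the values have geometric increments and converge in \<open>V\<close>, at
  a rate that does not depend on the time.
\<close>

lemma Linf_geometric_complete:
  assumes u: "\<And>n. u n \<in> Linf_time T V N"
    and step: "\<And>n. Linf_time_norm T N (u (Suc n) - u n) \<le> C * q ^ n"
    and q: "0 \<le> q" "q < 1"
  shows "\<exists>l\<in>Linf_time T V N. (\<lambda>n. Linf_time_norm T N (u n - l)) \<longlonglongrightarrow> 0"
proof -
  let ?M = "lebesgue_on {0<..<T}"
  have "AE t in ?M. u n t \<in> V \<and> N (u (Suc n) t - u n t) \<le> C * q ^ n" for n
    using Linf_diff_AE(1)[OF u u, of "Suc n" n]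
    by eventually_elim (use step[of n] in auto)
  then have good: "AE t in ?M. \<forall>n. u n t \<in> V \<and> N (u (Suc n) t - u n t) \<le> C * q ^ n"
    by (simp add: AE_all_countable)
  define l where "l t = (SOME l. l \<in> V \<and> (\<lambda>n. N (u n t - l)) \<longlonglongrightarrow> 0)" for t
  have l: "AE t in ?M. l t \<in> V \<and> (\<lambda>n. N (u n t - l t)) \<longlonglongrightarrow> 0 \<and>
      (\<forall>n. N (u n t - l t) \<le> C * q ^ n / (1 - q))"
    using good
  proof eventually_elim
    case (elim t)
    then have "\<exists>l. l \<in> V \<and> (\<lambda>n. N (u n t - l)) \<longlonglongrightarrow> 0"
      using geometric_complete[of "\<lambda>n. u n t" C q] q by blast
    then have "l t \<in> V \<and> (\<lambda>n. N (u n t - l t)) \<longlonglongrightarrow> 0"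
      unfolding l_def by (rule someI_ex)
    then have lt: "l t \<in> V" "(\<lambda>n. N (u n t - l t)) \<longlonglongrightarrow> 0" by auto
    have "N (u n t - l t) \<le> C * q ^ n / (1 - q)" for n
    proof (rule LIMSEQ_le_const)
      show "(\<lambda>m. C * q ^ n / (1 - q) + N (u m t - l t)) \<longlonglongrightarrow> C * q ^ n / (1 - q)"
        using tendsto_add[OF tendsto_const lt(2)] by simp
      have "N (u n t - l t) \<le> C * q ^ n / (1 - q) + N (u m t - l t)" if "m \<ge> n" for m
        using geometric_distance[of "\<lambda>n. u n t" C q n m] elim q that lt(1)
          triangle[of "u n t" "u m t" "l t"] minus_commute[of "u n t" "u m t"] by force
      then show "\<exists>N'. \<forall>m\<ge>N'. N (u n t - l t) \<le> C * q ^ n / (1 - q) + N (u m t - l t)" by blast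
    qed
    with lt show ?case by blast
  qed
  have C: "0 \<le> C" using order_trans[OF Linf_diff_AE(2)[OF u u] step[of 0]] by simp
  have le: "Linf_time_norm T N (u n - l) \<le> C * q ^ n / (1 - q)" for n
  proof (rule Linf_time_norm_le)
    show "AE t in ?M. N ((u n - l) t) \<le> C * q ^ n / (1 - q)" using l by (rule eventually_mono) simp
  qed (use q C in simp)
  have mem: "l \<in> Linf_time T V N"
    unfolding Linf_time_def
  proof (intro CollectI conjI)
    show lV: "AE t in ?M. l t \<in> V" using l by (rule eventually_mono) simp
    show "strongly_measurable T V N l"
    proof (rule strongly_measurable_limit[of T u])
      show "strongly_measurable T V N (u n)" for n using u[of n] by (simp add: Linf_time_def)
      show "AE t in ?M. \<forall>n. u n t \<in> V" using good by (rule eventually_mono) simp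
      show "AE t in ?M. (\<lambda>n. N (u n t - l t)) \<longlonglongrightarrow> 0" using l by (rule eventually_mono) simp
    qed (rule lV)
    obtain D where "AE t in ?M. N (u 0 t) \<le> D" using u[of 0] by (auto simp: Linf_time_def)
    then have "AE t in ?M. N (l t) \<le> D + C / (1 - q)"
      using l good
    proof eventually_elim
      case (elim t)
      then have "l t \<in> V" "u 0 t \<in> V" "N (u 0 t - l t) \<le> C / (1 - q)"
        by (auto dest: spec[of _ 0])
      then show ?case
        using le_add_diff[of "l t" "u 0 t"] minus_commute[of "l t" "u 0 t"] elim(1) by linarith
    qed
    then show "\<exists>C. AE t in ?M. N (l t) \<le> C" by blast
  qed
  have "(\<lambda>n. Linf_time_norm T N (u n - l)) \<longlonglongrightarrow> 0"
  proof (rule Lim_null_comparison)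
    show "\<forall>\<^sub>F n in sequentially. norm (Linf_time_norm T N (u n - l)) \<le> C * q ^ n / (1 - q)"
      using le Linf_diff_AE(2)[OF u mem] by simp
    show "(\<lambda>n. C * q ^ n / (1 - q)) \<longlonglongrightarrow> 0"
      using q by (intro tendsto_divide_zero tendsto_mult_right_zero LIMSEQ_realpow_zero) auto
  qed
  with mem show ?thesis by blast
qed

text \<open>
  Banach's fixed point theorem for a seminorm: the limit of an orbit is fixed up to seminorm
  zero only, and uniqueness holds in the same sense.
\<close>

lemma Linf_contraction_fixed_point:
  assumes B: "B \<subseteq> Linf_time T V N" "b \<in> B"
    and closed: "\<And>u l. (\<And>n. u n \<in> B) \<Longrightarrow> l \<in> Linf_time T V N \<Longrightarrow>
      (\<lambda>n. Linf_time_norm T N (u n - l)) \<longlonglongrightarrow> 0 \<Longrightarrow> l \<in> B"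
    and self: "\<And>u. u \<in> B \<Longrightarrow> F u \<in> B"
    and q: "0 \<le> q" "q < 1"
    and contraction: "\<And>u v. u \<in> B \<Longrightarrow> v \<in> B \<Longrightarrow>
      Linf_time_norm T N (F u - F v) \<le> q * Linf_time_norm T N (u - v)"
  shows "\<exists>l\<in>B. Linf_time_norm T N (F l - l) = 0 \<and>
     (\<forall>u\<in>B. Linf_time_norm T N (F u - u) = 0 \<longrightarrow> Linf_time_norm T N (u - l) = 0) \<and>
     (\<forall>u. u 0 \<in> B \<and> (\<forall>n. u (Suc n) = F (u n)) \<longrightarrow> (\<lambda>n. Linf_time_norm T N (u n - l)) \<longlonglongrightarrow> 0)"
proof -
  let ?N = "Linf_time_norm T N"
  have iter_mem: "u n \<in> B" if "u 0 \<in> B" "\<And>n. u (Suc n) = F (u n)" for u n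
    using that by (induction n) (auto intro: self)
  have nn: "0 \<le> ?N (u - v)" if "u \<in> B" "v \<in> B" for u v
    using that B Linf_diff_AE(2) by blast
  have tri: "?N (u - w) \<le> ?N (u - v) + ?N (v - w)" if "u \<in> B" "v \<in> B" "w \<in> B" for u v w
    using that B Linf_triangle by blast
  have comm: "?N (u - v) = ?N (v - u)" if "u \<in> B" "v \<in> B" for u v
    using that B Linf_minus_commute by blast
  define a where "a n = (F ^^ n) b" for n
  have a: "a 0 = b" "\<And>n. a (Suc n) = F (a n)" by (auto simp: a_def)
  have aB: "a n \<in> B" for n using iter_mem[of a] a B by simp
  define K where "K = ?N (a (Suc 0) - a 0)"
  have "?N (a (Suc n) - a n) \<le> K * q ^ n" for n
  proof (induction n)
    case 0
    show ?case by (simp only: K_def power_0 mult_1_right order_refl)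
  next
    case (Suc n)
    have "?N (a (Suc (Suc n)) - a (Suc n)) \<le> q * ?N (a (Suc n) - a n)"
      using contraction[OF aB aB, of "Suc n" n] by (simp only: a(2))
    also have "\<dots> \<le> q * (K * q ^ n)" by (rule mult_left_mono[OF Suc.IH q(1)])
    also have "\<dots> = K * q ^ Suc n" by simp
    finally show ?case .
  qed
  then obtain l where l: "l \<in> Linf_time T V N" "(\<lambda>n. ?N (a n - l)) \<longlonglongrightarrow> 0"
    using Linf_geometric_complete[of a T K q] aB B q by blast
  then have lB: "l \<in> B" using closed[of a l] aB by blast
  \<comment> \<open>Both \<open>F l\<close> and \<open>l\<close> are limits of the orbit.\<close>
  have "?N (F l - l) \<le> q * ?N (a n - l) + ?N (a (Suc n) - l)" for n
    using tri[OF self[OF lB] aB[of "Suc n"] lB] contraction[OF lB aB[of n]] comm[OF lB aB[of n]]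
    by (simp add: a(2))
  moreover have "(\<lambda>n. q * ?N (a n - l) + ?N (a (Suc n) - l)) \<longlonglongrightarrow> q * 0 + 0"
    by (intro tendsto_intros l(2) LIMSEQ_Suc[OF l(2)])
  ultimately have "?N (F l - l) \<le> 0" by (intro LIMSEQ_le_const[of _ "0 :: real"]) auto
  then have fixed: "?N (F l - l) = 0" using nn[OF self[OF lB] lB] by simp
  have uniq: "?N (u - l) = 0" if u: "u \<in> B" "?N (F u - u) = 0" for u
  proof -
    have "?N (u - l) \<le> ?N (u - F u) + (?N (F u - F l) + ?N (F l - l))"
      using tri[OF u(1) self[OF u(1)] lB] tri[OF self[OF u(1)] self[OF lB] lB] by linarith
    also have "\<dots> \<le> q * ?N (u - l)"
      using fixed u comm[OF u(1) self[OF u(1)]] contraction[OF u(1) lB] by simp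
    finally have "(1 - q) * ?N (u - l) \<le> 0" by (simp add: algebra_simps)
    then have "?N (u - l) \<le> 0" using q by (simp add: mult_le_0_iff)
    then show ?thesis using nn[OF u(1) lB] by simp
  qed
  have "(\<lambda>n. ?N (u n - l)) \<longlonglongrightarrow> 0" if u: "u 0 \<in> B" "\<And>n. u (Suc n) = F (u n)" for u
  proof -
    have uB: "u n \<in> B" for n using iter_mem[OF u] .
    have "?N (u n - l) \<le> q ^ n * ?N (u 0 - l)" for n
    proof (induction n)
      case (Suc n)
      have "?N (u (Suc n) - l) \<le> ?N (F (u n) - F l) + ?N (F l - l)"
        using tri[OF self[OF uB] self[OF lB] lB] by (simp add: u(2))
      also have "\<dots> \<le> q * ?N (u n - l)" using fixed contraction[OF uB lB] by simp
      also have "\<dots> \<le> q * (q ^ n * ?N (u 0 - l))" by (rule mult_left_mono[OF Suc.IH q(1)])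
      also have "\<dots> = q ^ Suc n * ?N (u 0 - l)" by simp
      finally show ?case .
    qed simp
    moreover have "(\<lambda>n. q ^ n * ?N (u 0 - l)) \<longlonglongrightarrow> 0"
      using q by (intro tendsto_mult_left_zero LIMSEQ_realpow_zero) auto
    ultimately show ?thesis
      using nn[OF uB lB] by (intro Lim_null_comparison[of "\<lambda>n. ?N (u n - l)"] always_eventually allI) auto
  qed
  with lB fixed uniq show ?thesis by blast
qed

end

section \<open>Fixed points of contractions of the ball\<close>

context sobolev_domain
begin

lemma Sobolev_complete_seminorm: "complete_function_seminorm (Sobolev k p \<Omega>) (Sobolev_norm k p \<Omega>)"
proof -
  interpret function_seminorm "Sobolev k p \<Omega>" "Sobolev_norm k p \<Omega>" by (rule Sobolev_seminorm)
  show ?thesis by unfold_locales (rule Sobolev_complete)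
qed

text \<open>
  This translates fixed points up to seminorm zero into fixed points almost everywhere, in both
  directions.
\<close>

lemma W_norm_zero_iff_ae_eq:
  assumes "u \<in> W_space \<Omega> p T" "v \<in> W_space \<Omega> p T"
  shows "W_norm \<Omega> p T (u - v) = 0 \<longleftrightarrow> ae_eq \<Omega> T u v"
proof -
  let ?M = "lebesgue_on {0<..<T}" and ?N = "Sobolev_norm 2 p \<Omega>"
  interpret function_seminorm "Sobolev 2 p \<Omega>" ?N by (rule Sobolev_seminorm)
  have uv: "u \<in> Linf_time T (Sobolev 2 p \<Omega>) ?N" "v \<in> Linf_time T (Sobolev 2 p \<Omega>) ?N"
    using assms by (auto simp: W_space_def)
  note ae = Linf_diff_AE(1)[OF uv, folded W_norm_def]
  show ?thesis
  proof
    assume "W_norm \<Omega> p T (u - v) = 0"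
    with ae have "AE t in ?M. u t \<in> Sobolev 2 p \<Omega> \<and> v t \<in> Sobolev 2 p \<Omega> \<and> ?N ((u - v) t) \<le> 0"
      by simp
    then show "ae_eq \<Omega> T u v"
      unfolding ae_eq_def
    proof (rule eventually_mono)
      fix t assume t: "u t \<in> Sobolev 2 p \<Omega> \<and> v t \<in> Sobolev 2 p \<Omega> \<and> ?N ((u - v) t) \<le> 0"
      then have mem: "u t - v t \<in> Sobolev 2 p \<Omega>" by (intro diff_mem) auto
      have "Lp_norm p \<Omega> (u t - v t) \<le> 0"
        using Lp_norm_le_Sobolev_norm[OF mem] t by simp
      then have "Lp_norm p \<Omega> (u t - v t) = 0" by (simp add: Lp_norm_def antisym)
      then have "AE x in lebesgue_on \<Omega>. (u t - v t) x = 0"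
        by (rule Lp_norm_eq_0_imp_AE[OF one_le_p Sobolev_subset_Lp(1)[OF mem]])
      then show "AE x in lebesgue_on \<Omega>. u t x = v t x" by simp
    qed
  next
    assume "ae_eq \<Omega> T u v"
    then have "AE t in ?M. AE x in lebesgue_on \<Omega>. u t x = v t x" by (simp add: ae_eq_def)
    with ae have "AE t in ?M. ?N ((u - v) t) \<le> 0"
    proof eventually_elim
      case (elim t)
      then have mem: "u t - v t \<in> Sobolev 2 p \<Omega>" by (intro diff_mem) auto
      have "AE x in lebesgue_on \<Omega>. (u t - v t) x = 0" using elim(2) by simp
      then have "?N (u t - v t) = 0"
        by (rule Sobolev_norm_AE_zero(2)[OF Sobolev_subset_Lp(1)[OF mem]])
      then show ?case by simp
    qed
    then have "Linf_time_norm T ?N (u - v) \<le> 0" by (intro Linf_time_norm_le) auto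
    then show "W_norm \<Omega> p T (u - v) = 0"
      using Linf_diff_AE(2)[OF uv] by (simp add: W_norm_def)
  qed
qed

lemma zero_mem_W_ball:
  assumes "R \<ge> 0"
  shows "(\<lambda>_ _. 0) \<in> W_ball \<Omega> p T R"
proof -
  let ?N = "Sobolev_norm 2 p \<Omega>"
  interpret function_seminorm "Sobolev 2 p \<Omega>" ?N by (rule Sobolev_seminorm)
  have "strongly_measurable T (Sobolev 2 p \<Omega>) ?N (\<lambda>_ _. 0)"
    unfolding strongly_measurable_def
  proof (intro exI[of _ "\<lambda>_ _ _. 0"] conjI allI)
    show "(\<lambda>_ _. 0) ` {0<..<T} \<subseteq> Sobolev 2 p \<Omega>" using zero_mem by auto
    show "AE t in lebesgue_on {0<..<T}. (\<lambda>n. ?N ((\<lambda>_. 0) - (\<lambda>_. 0))) \<longlonglongrightarrow> 0"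
      unfolding diff_self by simp
  qed simp
  moreover have "Linf_time_norm T ?N (\<lambda>_ _. 0) \<le> R"
    using assms zero by (intro Linf_time_norm_le) auto
  ultimately show ?thesis
    using zero zero_mem by (auto simp: W_ball_def W_space_def W_norm_def Linf_time_def)
qed

text \<open>
  At almost every time the limit is a limit in the Sobolev norm.  This preserves the bound by
  the triangle inequality and the zero mean by convergence in \<open>L\<^sup>p\<close>.
\<close>

lemma W_ball_closed:
  assumes u: "\<And>n. u n \<in> W_ball \<Omega> p T R" and R: "R \<ge> 0"
    and l: "l \<in> Linf_time T (Sobolev 2 p \<Omega>) (Sobolev_norm 2 p \<Omega>)"
    and lim: "(\<lambda>n. Linf_time_norm T (Sobolev_norm 2 p \<Omega>) (u n - l)) \<longlonglongrightarrow> 0"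
  shows "l \<in> W_ball \<Omega> p T R"
proof -
  let ?M = "lebesgue_on {0<..<T}" and ?N = "Sobolev_norm 2 p \<Omega>"
  interpret function_seminorm "Sobolev 2 p \<Omega>" ?N by (rule Sobolev_seminorm)
  have uL: "u n \<in> Linf_time T (Sobolev 2 p \<Omega>) ?N" for n
    using u[of n] by (simp add: W_ball_def W_space_def)
  have "AE t in ?M. ?N (u n t) \<le> R" for n
  proof -
    obtain C where "AE t in ?M. ?N (u n t) \<le> C" using uL[of n] by (auto simp: Linf_time_def)
    from Linf_time_norm_AE[where N = ?N and u = "u n", OF this] show ?thesis
      by (rule eventually_mono) (use u[of n] in \<open>simp add: W_ball_def W_norm_def\<close>)
  qed
  moreover have "AE t in ?M. (LINT x|lebesgue_on \<Omega>. u n t x) = 0" for n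
    using u[of n] by (simp add: W_ball_def W_space_def)
  moreover note Linf_diff_AE(1)[OF uL l]
  ultimately have "AE t in ?M. ?N (u n t) \<le> R \<and> (LINT x|lebesgue_on \<Omega>. u n t x) = 0 \<and>
      u n t \<in> Sobolev 2 p \<Omega> \<and> l t \<in> Sobolev 2 p \<Omega> \<and> ?N (u n t - l t) \<le> Linf_time_norm T ?N (u n - l)" for n
    by simp
  then have "AE t in ?M. \<forall>n. ?N (u n t) \<le> R \<and> (LINT x|lebesgue_on \<Omega>. u n t x) = 0 \<and>
      u n t \<in> Sobolev 2 p \<Omega> \<and> l t \<in> Sobolev 2 p \<Omega> \<and> ?N (u n t - l t) \<le> Linf_time_norm T ?N (u n - l)"
    by (simp only: AE_all_countable) simp
  then have ae: "AE t in ?M. ?N (l t) \<le> R \<and> (LINT x|lebesgue_on \<Omega>. l t x) = 0"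
  proof (rule eventually_mono)
    fix t assume t: "\<forall>n. ?N (u n t) \<le> R \<and> (LINT x|lebesgue_on \<Omega>. u n t x) = 0 \<and>
      u n t \<in> Sobolev 2 p \<Omega> \<and> l t \<in> Sobolev 2 p \<Omega> \<and> ?N (u n t - l t) \<le> Linf_time_norm T ?N (u n - l)"
    then have mem: "\<And>n. u n t \<in> Sobolev 2 p \<Omega>" "l t \<in> Sobolev 2 p \<Omega>" by auto
    have le: "?N (l t) \<le> R + Linf_time_norm T ?N (u n - l)" for n
      using le_add_diff[OF mem(2,1), of n] minus_commute[OF mem(2,1), of n] t[rule_format, of n] by linarith
    have "(\<lambda>n. R + Linf_time_norm T ?N (u n - l)) \<longlonglongrightarrow> R"
      using tendsto_add[OF tendsto_const lim] by simp
    then have "?N (l t) \<le> R" by (rule LIMSEQ_le_const) (use le in blast)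
    have "(\<lambda>n. Lp_norm p \<Omega> (u n t - l t)) \<longlonglongrightarrow> 0"
    proof (rule Lim_null_comparison[OF always_eventually[OF allI] lim])
      fix n
      have "Lp_norm p \<Omega> (u n t - l t) \<le> Linf_time_norm T ?N (u n - l)"
        using Lp_norm_le_Sobolev_norm[OF diff_mem[OF mem(1)[of n] mem(2)]] t[rule_format, of n] by linarith
      then show "norm (Lp_norm p \<Omega> (u n t - l t)) \<le> Linf_time_norm T ?N (u n - l)"
        by (simp add: Lp_norm_def)
    qed
    then have "(\<lambda>n. LINT x|lebesgue_on \<Omega>. u n t x * 1) \<longlonglongrightarrow> (LINT x|lebesgue_on \<Omega>. l t x * 1)"
      by (rule Lp_convergence_imp_weak[OF one_le_p finite_measure_domain
            Sobolev_subset_Lp(1)[OF mem(1)] Sobolev_subset_Lp(1)[OF mem(2)], where B = 1]) auto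
    then have "(LINT x|lebesgue_on \<Omega>. l t x) = 0"
      using t by (simp add: LIMSEQ_const_iff)
    with \<open>?N (l t) \<le> R\<close> show "?N (l t) \<le> R \<and> (LINT x|lebesgue_on \<Omega>. l t x) = 0" ..
  qed
  then have "Linf_time_norm T ?N l \<le> R"
    using R by (intro Linf_time_norm_le) (auto intro: eventually_mono[OF ae])
  moreover have "AE t in ?M. (LINT x|lebesgue_on \<Omega>. l t x) = 0"
    using ae by (rule eventually_mono) simp
  ultimately show ?thesis
    using l by (simp add: W_ball_def W_space_def W_norm_def)
qed

lemma LinfLp_norm_diff_nonneg:
  assumes "u \<in> X_space \<Omega> p T" "v \<in> X_space \<Omega> p T"
  shows "0 \<le> LinfLp_norm \<Omega> p T (u - v)"
  by (rule function_seminorm.Linf_diff_AE(2)[OF Lp_seminorm[OF one_le_p]])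
    (use assms in \<open>simp_all add: X_space_def\<close>)

lemma W_ball_contraction_fixed_point:
  assumes R: "R \<ge> 0" and self: "F ` W_ball \<Omega> p T R \<subseteq> W_ball \<Omega> p T R"
    and q: "0 \<le> q" "q < 1"
    and contraction: "\<And>\<psi> \<psi>'. \<psi> \<in> W_ball \<Omega> p T R \<Longrightarrow> \<psi>' \<in> W_ball \<Omega> p T R \<Longrightarrow>
      W_norm \<Omega> p T (F \<psi> - F \<psi>') \<le> q * W_norm \<Omega> p T (\<psi> - \<psi>')"
  shows "\<exists>l\<in>W_ball \<Omega> p T R. ae_eq \<Omega> T (F l) l \<and>
     (\<forall>\<psi>\<in>W_ball \<Omega> p T R. ae_eq \<Omega> T (F \<psi>) \<psi> \<longrightarrow> ae_eq \<Omega> T \<psi> l) \<and>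
     (\<forall>\<psi>. \<psi> 0 \<in> W_ball \<Omega> p T R \<and> (\<forall>n. \<psi> (Suc n) = F (\<psi> n)) \<longrightarrow>
        (\<lambda>n. W_norm \<Omega> p T (\<psi> n - l)) \<longlonglongrightarrow> 0)"
proof -
  let ?B = "W_ball \<Omega> p T R"
  interpret complete_function_seminorm "Sobolev 2 p \<Omega>" "Sobolev_norm 2 p \<Omega>"
    by (rule Sobolev_complete_seminorm)
  have ae: "ae_eq \<Omega> T u v \<longleftrightarrow> W_norm \<Omega> p T (u - v) = 0" if "u \<in> ?B" "v \<in> ?B" for u v
    using that W_norm_zero_iff_ae_eq by (simp add: W_ball_def)
  have F: "F \<psi> \<in> ?B" if "\<psi> \<in> ?B" for \<psi> using self that by blast
  have "\<exists>l\<in>?B. W_norm \<Omega> p T (F l - l) = 0 \<and>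
     (\<forall>u\<in>?B. W_norm \<Omega> p T (F u - u) = 0 \<longrightarrow> W_norm \<Omega> p T (u - l) = 0) \<and>
     (\<forall>u. u 0 \<in> ?B \<and> (\<forall>n. u (Suc n) = F (u n)) \<longrightarrow> (\<lambda>n. W_norm \<Omega> p T (u n - l)) \<longlonglongrightarrow> 0)"
    unfolding W_norm_def
  proof (rule Linf_contraction_fixed_point[OF _ zero_mem_W_ball[OF R] W_ball_closed[OF _ R] F q])
    show "?B \<subseteq> Linf_time T (Sobolev 2 p \<Omega>) (Sobolev_norm 2 p \<Omega>)"
      by (auto simp: W_ball_def W_space_def)
  qed (use contraction in \<open>simp_all add: W_norm_def\<close>)
  then obtain l where l: "l \<in> ?B" "W_norm \<Omega> p T (F l - l) = 0"
    "\<forall>u\<in>?B. W_norm \<Omega> p T (F u - u) = 0 \<longrightarrow> W_norm \<Omega> p T (u - l) = 0"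
    "\<forall>u. u 0 \<in> ?B \<and> (\<forall>n. u (Suc n) = F (u n)) \<longrightarrow> (\<lambda>n. W_norm \<Omega> p T (u n - l)) \<longlonglongrightarrow> 0"
    by blast
  have "ae_eq \<Omega> T (F l) l" using ae[OF F[OF l(1)] l(1)] l(2) by simp
  moreover have "ae_eq \<Omega> T \<psi> l" if "\<psi> \<in> ?B" "ae_eq \<Omega> T (F \<psi>) \<psi>" for \<psi>
    using that l(3) ae[OF F[OF that(1)] that(1)] ae[OF that(1) l(1)] by simp
  ultimately show ?thesis using l(1,4) by blast
qed

end

lemma NP_operator_mem_X_space:
  assumes "NP_uniquely_solvable \<Omega> p T D z g \<psi>"
  shows "NP_operator \<Omega> p T D z g \<psi> \<in> X_space \<Omega> p T"
proof -
  have "\<exists>c. c \<in> X_space \<Omega> p T \<and> NP_solution \<Omega> T D z g \<psi> c"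
    using assms by (auto simp: NP_uniquely_solvable_def)
  from someI_ex[OF this] show ?thesis by (simp add: NP_operator_def)
qed

theorem theorem3p11:
  fixes \<Omega> :: "'a::euclidean_space set"
    and p R T0 \<epsilon>p C_R C_P :: real
    and D z :: "nat \<Rightarrow> real"
    and g :: "nat \<Rightarrow> 'a \<Rightarrow> real"
    and S :: "real \<Rightarrow> nat \<Rightarrow> (real \<Rightarrow> 'a \<Rightarrow> real) \<Rightarrow> real \<Rightarrow> 'a \<Rightarrow> real"
    and P :: "real \<Rightarrow> (nat \<Rightarrow> real \<Rightarrow> 'a \<Rightarrow> real) \<Rightarrow> real \<Rightarrow> 'a \<Rightarrow> real"
    and \<T> :: "real \<Rightarrow> (real \<Rightarrow> 'a \<Rightarrow> real) \<Rightarrow> real \<Rightarrow> 'a \<Rightarrow> real"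
    and M0 :: "nat \<Rightarrow> real"
  defines "S \<equiv> \<lambda>T i. NP_operator \<Omega> p T (D i) (z i) (g i)"
    and "P \<equiv> \<lambda>T. Poisson_operator \<Omega> p T z \<epsilon>p"
    and "\<T> \<equiv> \<lambda>T \<psi>. P T (\<lambda>i. S T i \<psi>)"
    and "M0 \<equiv> \<lambda>i. LINT x|lebesgue_on \<Omega>. g i x"
  assumes domain: "C11_bounded_domain \<Omega>"
    and p: "p > real DIM('a)"
    and pos: "R > 0" "T0 > 0" "D 1 > 0" "D 2 > 0" "\<epsilon>p > 0"
    and constants: "C_R \<ge> 0" "C_P \<ge> 0"
    and initial: "\<forall>i\<in>{1,2}. integrable (lebesgue_on \<Omega>) (g i)"
    and neutral: "z 1 * M0 1 + z 2 * M0 2 = 0"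
    and NP_wellposed: "\<And>T \<psi>. 0 < T \<Longrightarrow> T \<le> T0 \<Longrightarrow> \<psi> \<in> W_ball \<Omega> p T R \<Longrightarrow>
          (\<forall>i\<in>{1,2}. NP_uniquely_solvable \<Omega> p T (D i) (z i) (g i) \<psi> \<and>
             (AE t in lebesgue_on {0<..<T}. (LINT x|lebesgue_on \<Omega>. S T i \<psi> t x) = M0 i) \<and>
             S T i \<psi> \<in> LinfQ \<Omega> T) \<and>
          (\<Sum>i\<in>{1,2}. X_norm \<Omega> p T (S T i \<psi>)) + (\<Sum>i\<in>{1,2}. LinfQ_norm \<Omega> T (S T i \<psi>)) \<le> C_R"
    and NP_stability: "\<And>T \<psi> \<psi>'. 0 < T \<Longrightarrow> T \<le> T0 \<Longrightarrow>
          \<psi> \<in> W_ball \<Omega> p T R \<Longrightarrow> \<psi>' \<in> W_ball \<Omega> p T R \<Longrightarrow>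
          (\<Sum>i\<in>{1,2}. LinfLp_norm \<Omega> p T (S T i \<psi> - S T i \<psi>'))
            \<le> C_R * sqrt T * W_norm \<Omega> p T (\<psi> - \<psi>')"
    and Poisson_solvable: "\<And>T c. 0 < T \<Longrightarrow> T \<le> T0 \<Longrightarrow> c \<in> admissible \<Omega> p T z \<Longrightarrow>
          Poisson_solutions \<Omega> p T z \<epsilon>p c \<noteq> {}"
    and Poisson_stability: "\<And>T c c'. 0 < T \<Longrightarrow> T \<le> T0 \<Longrightarrow>
          c \<in> admissible \<Omega> p T z \<Longrightarrow> c' \<in> admissible \<Omega> p T z \<Longrightarrow>
          W_norm \<Omega> p T (P T c - P T c') \<le> C_P * (\<Sum>i\<in>{1,2}. LinfLp_norm \<Omega> p T (c i - c' i))"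
    and invariant: "\<And>T. 0 < T \<Longrightarrow> T \<le> T0 \<Longrightarrow> \<T> T ` W_ball \<Omega> p T R \<subseteq> W_ball \<Omega> p T R"
  shows "\<exists>Ts. 0 < Ts \<and> Ts \<le> T0 \<and>
    (\<forall>T. 0 < T \<and> T \<le> Ts \<longrightarrow>
       C_P * C_R * sqrt T < 1 \<and>
       (\<forall>\<psi>\<in>W_ball \<Omega> p T R. \<forall>\<psi>'\<in>W_ball \<Omega> p T R.
          W_norm \<Omega> p T (\<T> T \<psi> - \<T> T \<psi>') \<le> C_P * C_R * sqrt T * W_norm \<Omega> p T (\<psi> - \<psi>')) \<and>
       (\<exists>\<psi>s\<in>W_ball \<Omega> p T R.
          ae_eq \<Omega> T (\<T> T \<psi>s) \<psi>s \<and>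
          (\<forall>\<psi>\<in>W_ball \<Omega> p T R. ae_eq \<Omega> T (\<T> T \<psi>) \<psi> \<longrightarrow> ae_eq \<Omega> T \<psi> \<psi>s) \<and>
          (\<forall>\<psi> :: nat \<Rightarrow> real \<Rightarrow> 'a \<Rightarrow> real.
             \<psi> 0 \<in> W_ball \<Omega> p T R \<and> (\<forall>n. \<psi> (Suc n) = \<T> T (\<psi> n)) \<longrightarrow>
             (\<lambda>n. W_norm \<Omega> p T (\<psi> n - \<psi>s)) \<longlonglongrightarrow> 0 \<and>
             (\<forall>i\<in>{1,2}. (\<lambda>n. LinfLp_norm \<Omega> p T (S T i (\<psi> n) - S T i \<psi>s)) \<longlonglongrightarrow> 0))))"
proof -
  have d1: "real DIM('a) \<ge> 1" by (simp add: DIM_positive Suc_leI)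
  interpret sobolev_domain \<Omega> p
  proof (rule sobolev_domain.intro)
    show "1 \<le> p" using d1 p by linarith
    show "open \<Omega>" using domain by (simp add: C11_bounded_domain_def)
    have "\<Omega> \<in> lmeasurable" using domain by (auto simp: C11_bounded_domain_def intro: lmeasurable_open)
    then show "finite_measure (lebesgue_on \<Omega>)" by (rule finite_measure_lebesgue_on)
  qed
  define K where "K = C_P * C_R"
  have K: "K \<ge> 0" using constants by (simp add: K_def)
  \<comment> \<open>At this time \<open>K * sqrt T\<close> is at most \<open>K / (K + 1)\<close>, which covers the case \<open>K = 0\<close> as well.\<close>
  define Ts where "Ts = min T0 ((1 / (K + 1))\<^sup>2)"
  have Ts: "0 < Ts" "Ts \<le> T0" using pos K by (auto simp: Ts_def)
  have "K * sqrt T < 1 \<and>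
      (\<forall>\<psi>\<in>W_ball \<Omega> p T R. \<forall>\<psi>'\<in>W_ball \<Omega> p T R.
         W_norm \<Omega> p T (\<T> T \<psi> - \<T> T \<psi>') \<le> K * sqrt T * W_norm \<Omega> p T (\<psi> - \<psi>')) \<and>
      (\<exists>\<psi>s\<in>W_ball \<Omega> p T R.
         ae_eq \<Omega> T (\<T> T \<psi>s) \<psi>s \<and>
         (\<forall>\<psi>\<in>W_ball \<Omega> p T R. ae_eq \<Omega> T (\<T> T \<psi>) \<psi> \<longrightarrow> ae_eq \<Omega> T \<psi> \<psi>s) \<and>
         (\<forall>\<psi> :: nat \<Rightarrow> real \<Rightarrow> 'a \<Rightarrow> real.
            \<psi> 0 \<in> W_ball \<Omega> p T R \<and> (\<forall>n. \<psi> (Suc n) = \<T> T (\<psi> n)) \<longrightarrow>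
            (\<lambda>n. W_norm \<Omega> p T (\<psi> n - \<psi>s)) \<longlonglongrightarrow> 0 \<and>
            (\<forall>i\<in>{1,2}. (\<lambda>n. LinfLp_norm \<Omega> p T (S T i (\<psi> n) - S T i \<psi>s)) \<longlonglongrightarrow> 0)))"
    if T: "0 < T" "T \<le> Ts" for T
  proof -
    let ?B = "W_ball \<Omega> p T R"
    have T0: "T \<le> T0" using T Ts by simp
    have "sqrt T \<le> 1 / (K + 1)"
      using T K by (intro real_le_lsqrt) (auto simp: Ts_def)
    then have "K * sqrt T \<le> K * (1 / (K + 1))" using K by (intro mult_left_mono)
    also have "\<dots> < 1" using K by simp
    finally have q1: "K * sqrt T < 1" .
    have q0: "0 \<le> K * sqrt T" using K T by simp
    have X: "S T i \<psi> \<in> X_space \<Omega> p T" if "\<psi> \<in> ?B" "i \<in> {1,2}" for \<psi> i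
      using NP_wellposed[OF T(1) T0 that(1)] that(2) unfolding S_def
      by (intro NP_operator_mem_X_space) blast
    have admissible: "(\<lambda>i. S T i \<psi>) \<in> admissible \<Omega> p T z" if "\<psi> \<in> ?B" for \<psi>
    proof -
      have "AE t in lebesgue_on {0<..<T}. (LINT x|lebesgue_on \<Omega>. S T i \<psi> t x) = M0 i" if "i \<in> {1,2}" for i
        using NP_wellposed[OF T(1) T0 \<open>\<psi> \<in> ?B\<close>] that by blast
      then have "AE t in lebesgue_on {0<..<T}. (LINT x|lebesgue_on \<Omega>. S T 1 \<psi> t x) = M0 1"
        "AE t in lebesgue_on {0<..<T}. (LINT x|lebesgue_on \<Omega>. S T 2 \<psi> t x) = M0 2"
        by blast+
      then have "AE t in lebesgue_on {0<..<T}. (\<Sum>i\<in>{1,2}. z i * (LINT x|lebesgue_on \<Omega>. S T i \<psi> t x)) = 0"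
        by eventually_elim (use neutral in simp)
      then show ?thesis using X[OF that] by (simp add: admissible_def)
    qed
    have contraction: "W_norm \<Omega> p T (\<T> T \<psi> - \<T> T \<psi>') \<le> K * sqrt T * W_norm \<Omega> p T (\<psi> - \<psi>')"
      if "\<psi> \<in> ?B" "\<psi>' \<in> ?B" for \<psi> \<psi>'
    proof -
      have "W_norm \<Omega> p T (\<T> T \<psi> - \<T> T \<psi>')
          \<le> C_P * (\<Sum>i\<in>{1,2}. LinfLp_norm \<Omega> p T (S T i \<psi> - S T i \<psi>'))"
        unfolding \<T>_def by (rule Poisson_stability[OF T(1) T0 admissible[OF that(1)] admissible[OF that(2)]])
      also have "\<dots> \<le> C_P * (C_R * sqrt T * W_norm \<Omega> p T (\<psi> - \<psi>'))"
        by (rule mult_left_mono[OF NP_stability[OF T(1) T0 that] constants(2)])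
      also have "\<dots> = K * sqrt T * W_norm \<Omega> p T (\<psi> - \<psi>')"
        unfolding K_def by (simp only: mult.assoc)
      finally show ?thesis .
    qed
    obtain \<psi>s where s: "\<psi>s \<in> ?B" "ae_eq \<Omega> T (\<T> T \<psi>s) \<psi>s"
      "\<forall>\<psi>\<in>?B. ae_eq \<Omega> T (\<T> T \<psi>) \<psi> \<longrightarrow> ae_eq \<Omega> T \<psi> \<psi>s"
      "\<forall>\<psi>. \<psi> 0 \<in> ?B \<and> (\<forall>n. \<psi> (Suc n) = \<T> T (\<psi> n)) \<longrightarrow> (\<lambda>n. W_norm \<Omega> p T (\<psi> n - \<psi>s)) \<longlonglongrightarrow> 0"
      using W_ball_contraction_fixed_point[OF less_imp_le[OF pos(1)] invariant[OF T(1) T0] q0 q1 contraction]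
      by blast
    have species: "(\<lambda>n. LinfLp_norm \<Omega> p T (S T i (\<psi> n) - S T i \<psi>s)) \<longlonglongrightarrow> 0"
      if \<psi>: "\<psi> 0 \<in> ?B" "\<forall>n. \<psi> (Suc n) = \<T> T (\<psi> n)" and i: "i \<in> {1,2}" for \<psi> :: "nat \<Rightarrow> real \<Rightarrow> 'a \<Rightarrow> real" and i
    proof (rule Lim_null_comparison[OF always_eventually[OF allI]])
      have \<psi>B: "\<psi> n \<in> ?B" for n
        using \<psi> invariant[OF T(1) T0] by (induction n) auto
      fix n
      have nonneg: "0 \<le> LinfLp_norm \<Omega> p T (S T j (\<psi> n) - S T j \<psi>s)" if "j \<in> {1,2}" for j
        by (rule LinfLp_norm_diff_nonneg[OF X[OF \<psi>B that] X[OF s(1) that]])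
      have "LinfLp_norm \<Omega> p T (S T i (\<psi> n) - S T i \<psi>s)
          \<le> (\<Sum>j\<in>{1,2}. LinfLp_norm \<Omega> p T (S T j (\<psi> n) - S T j \<psi>s))"
        by (rule member_le_sum[OF i]) (use nonneg in auto)
      also have "\<dots> \<le> C_R * sqrt T * W_norm \<Omega> p T (\<psi> n - \<psi>s)"
        by (rule NP_stability[OF T(1) T0 \<psi>B s(1)])
      finally show "norm (LinfLp_norm \<Omega> p T (S T i (\<psi> n) - S T i \<psi>s))
          \<le> C_R * sqrt T * W_norm \<Omega> p T (\<psi> n - \<psi>s)"
        using nonneg[OF i] by simp
    next
      show "(\<lambda>n. C_R * sqrt T * W_norm \<Omega> p T (\<psi> n - \<psi>s)) \<longlonglongrightarrow> 0"
        using s(4) \<psi> by (intro tendsto_mult_right_zero) blast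
    qed
    show ?thesis using q1 contraction s species by blast
  qed
  then show ?thesis unfolding K_def using Ts by blast
qed

end
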